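(* Let $n\in\mathbb{N}$, let $H\in\mathbb{C}^{2^n\times 2^n}$ be a nonzero positive semidefinite Hermitian matrix, and let $\psi\in\mathbb{C}^{2^n}$ with $\|\psi\|=1$. Let $\epsilon,\delta\in(0,1]$, let $K,M\in\mathbb{N}$ be positive integers, and let $t>0$. Let $\psi(t)=e^{iHt}\psi$ and let $\widehat{\psi}_{K,M}(t)$ be the random vector produced from $M$ sampled indices and truncation order $K$ by the procedure defined in the context. If $$K\ \ge\ e\,t\,\|H\|+\log\frac{2}{\epsilon},\qquad M\ \ge\ \max\left(405\,\mathrm{Tr}(H),\ \frac{72\,\mathrm{Tr}(H)\,t}{\epsilon}\log\frac{36\,\mathrm{Tr}(H)\,t}{\epsilon\,\delta}\right),$$ then, with probability at least $1-\delta$ over the sampled indices, $$\|\psi(t)-\widehat{\psi}_{K,M}(t)\|\le\epsilon .$$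
   Context: $\|\cdot\|$ is the Euclidean norm for vectors and the spectral (operator) norm for matrices; $\log$ is the natural logarithm and $e$ in $e\,t\|H\|$ is Euler's number; $X^*$ is the conjugate transpose and $X^{+}$ the Moore--Penrose pseudoinverse of $X$. Procedure defining $\widehat{\psi}_{K,M}(t)$. Let $h_q=H_{q,q}$. Draw indices $t_1,\dots,t_M$ independently (with repetition) from $\{1,\dots,2^n\}$ with probabilities $p(q)=h_q/\sum_i h_i=h_q/\mathrm{Tr}(H)$. Let $A\in\mathbb{C}^{2^n\times M}$ with $A_{i,j}=H_{i,t_j}$, and $B\in\mathbb{C}^{M\times M}$ with $B_{i,j}=H_{t_i,t_j}$. Set $\widehat{H}=AB^{+}A^*$, $D=B^{+}A^*A$ and $v=B^{+}A^*\psi$. Let $g_K(x)=\sum_{k=1}^{K}\frac{(it)^k}{k!}x^{k-1}$ (the first $K$ terms of the power series of $(e^{itx}-1)/x$). Define $$\widehat{\psi}_{K,M}(t)=\psi+A\,g_K(D)\,v=(I+g_K(\widehat{H})\widehat{H})\psi .$$ Equivalently $\widehat{\psi}_{K,M}(t)=\psi+A\,b_{K-1}$ where $b_0=\frac{(it)^K}{K!}v$ and $b_j=\frac{(it)^{K-j}}{(K-j)!}v+D\,b_{j-1}$ for $1\le j\le K-1$. *)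

theory Defs
  imports "HOL-Analysis.Analysis" "HOL-Probability.Probability"
begin

definition conj_transpose :: "complex^'c^'r \<Rightarrow> complex^'r^'c" where
  "conj_transpose X = map_matrix cnj (transpose X)"

definition hermitian :: "complex^'d^'d \<Rightarrow> bool" where
  "hermitian X \<longleftrightarrow> conj_transpose X = X"

text \<open>For Hermitian \<open>X\<close> the quadratic form is real, so only its real part is compared with \<open>0\<close>.\<close>

definition psd :: "complex^'d^'d \<Rightarrow> bool" where
  "psd X \<longleftrightarrow> hermitian X \<and> (\<forall>x. 0 \<le> Re (\<Sum>i\<in>UNIV. cnj (x $ i) * (X *v x) $ i))"

definition spectral_norm :: "complex^'c^'r \<Rightarrow> real" where
  "spectral_norm X = onorm (\<lambda>x. X *v x)"

text \<open>The four Penrose conditions determine \<open>Y\<close> uniquely, and a solution exists for every \<open>X\<close>.\<close>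

definition pseudoinverse :: "complex^'c^'r \<Rightarrow> complex^'r^'c" where
  "pseudoinverse X = (THE Y. X ** Y ** X = X \<and> Y ** X ** Y = Y
     \<and> hermitian (X ** Y) \<and> hermitian (Y ** X))"

text \<open>The library's \<open>*\<close> and \<open>^\<close> on vectors, hence on matrices, are entrywise, so powers with
  respect to \<open>**\<close> are iterated explicitly.\<close>

definition matrix_scale :: "complex \<Rightarrow> complex^'c^'r \<Rightarrow> complex^'c^'r" where
  "matrix_scale c X = map_matrix (\<lambda>z. c * z) X"

definition matrix_pow :: "complex^'d^'d \<Rightarrow> nat \<Rightarrow> complex^'d^'d" where
  "matrix_pow X k = (((**) X) ^^ k) (mat 1)"

definition matrix_exp :: "complex^'d^'d \<Rightarrow> complex^'d^'d" where
  "matrix_exp X = (\<Sum>k. matrix_scale (1 / fact k) (matrix_pow X k))"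

definition evolved_state :: "complex^'d^'d \<Rightarrow> complex^'d \<Rightarrow> real \<Rightarrow> complex^'d" where
  "evolved_state H \<psi> t = matrix_exp (matrix_scale (\<i> * of_real t) H) *v \<psi>"

definition real_trace :: "complex^'d^'d \<Rightarrow> real" where
  "real_trace H = Re (trace H)"

text \<open>The weights form a probability mass function whenever \<open>H\<close> is nonzero and positive
  semidefinite; see \<open>pmf_index_pmf\<close> below.\<close>

definition index_pmf :: "complex^'d^'d \<Rightarrow> 'd pmf" where
  "index_pmf H = embed_pmf (\<lambda>q. Re (H $ q $ q) / real_trace H)"

text \<open>A sample of \<open>M\<close> indices is a function on an index type \<open>'m\<close> with \<open>CARD('m) = M\<close>; its
  values are independent with common distribution \<open>index_pmf H\<close>. The default value of
  \<open>Pi_pmf\<close> is irrelevant because the index set is all of \<open>'m\<close>.\<close>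

definition sample_pmf :: "complex^'d^'d \<Rightarrow> ('m::finite \<Rightarrow> 'd) pmf" where
  "sample_pmf H = Pi_pmf UNIV undefined (\<lambda>_. index_pmf H)"

definition nystroem_A :: "complex^'d^'d \<Rightarrow> ('m \<Rightarrow> 'd) \<Rightarrow> complex^'m^'d" where
  "nystroem_A H \<tau> = (\<chi> i j. H $ i $ \<tau> j)"

definition nystroem_B :: "complex^'d^'d \<Rightarrow> ('m \<Rightarrow> 'd) \<Rightarrow> complex^'m^'m" where
  "nystroem_B H \<tau> = (\<chi> i j. H $ \<tau> i $ \<tau> j)"

definition nystroem_D :: "complex^'d^'d \<Rightarrow> ('m \<Rightarrow> 'd) \<Rightarrow> complex^'m^'m" where
  "nystroem_D H \<tau> = pseudoinverse (nystroem_B H \<tau>) ** conj_transpose (nystroem_A H \<tau>)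
     ** nystroem_A H \<tau>"

definition nystroem_v :: "complex^'d^'d \<Rightarrow> ('m \<Rightarrow> 'd) \<Rightarrow> complex^'d \<Rightarrow> complex^'m" where
  "nystroem_v H \<tau> \<psi> =
     (pseudoinverse (nystroem_B H \<tau>) ** conj_transpose (nystroem_A H \<tau>)) *v \<psi>"

text \<open>The first \<open>K\<close> terms of the power series of \<open>(exp (\<i> t x) - 1) / x\<close>, at a matrix \<open>x\<close>.\<close>

definition g_trunc :: "nat \<Rightarrow> real \<Rightarrow> complex^'d^'d \<Rightarrow> complex^'d^'d" where
  "g_trunc K t X =
     (\<Sum>k=1..K. matrix_scale ((\<i> * of_real t) ^ k / fact k) (matrix_pow X (k - 1)))"

definition approx_state ::
  "complex^'d^'d \<Rightarrow> complex^'d \<Rightarrow> nat \<Rightarrow> real \<Rightarrow> ('m::finite \<Rightarrow> 'd) \<Rightarrow> complex^'d" where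
  "approx_state H \<psi> K t \<tau> =
     \<psi> + nystroem_A H \<tau> *v (g_trunc K t (nystroem_D H \<tau>) *v nystroem_v H \<tau> \<psi>)"


lemma conj_transpose_nth [simp]: "conj_transpose X $ i $ j = cnj (X $ j $ i)"
  by (simp add: conj_transpose_def map_matrix_def transpose_def)

lemma quadratic_form_two_entries:
  fixes H :: "complex^'d^'d" and x :: "complex^'d"
  assumes "p \<noteq> q" and x: "x = (\<chi> i. if i = p then a else if i = q then b else 0)"
  shows "(\<Sum>i\<in>UNIV. cnj (x $ i) * (H *v x) $ i) =
    cnj a * (H $ p $ p * a + H $ p $ q * b) + cnj b * (H $ q $ p * a + H $ q $ q * b)"
proof -
  have *: "(\<Sum>j\<in>UNIV. f j) = f p + f q" if "\<And>j. j \<noteq> p \<Longrightarrow> j \<noteq> q \<Longrightarrow> f j = 0" for f :: "'d \<Rightarrow> complex"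
  proof -
    have "(\<Sum>j\<in>UNIV. f j) = (\<Sum>j\<in>{p, q}. f j)"
      by (rule sum.mono_neutral_right) (use that in auto)
    then show ?thesis using assms(1) by simp
  qed
  have "(H *v x) $ i = H $ i $ p * a + H $ i $ q * b" for i
    unfolding matrix_vector_mult_def using assms(1) by (simp add: * x)
  then show ?thesis using assms(1) by (simp add: * x)
qed

lemma quadratic_form_axis:
  fixes H :: "complex^'d^'d"
  shows "(\<Sum>i\<in>UNIV. cnj (axis q 1 $ i) * (H *v axis q 1) $ i) = H $ q $ q"
proof -
  have "cnj (axis q 1 $ i) * (H *v axis q 1) $ i = (if i = q then H $ q $ q else 0)" for i
    unfolding matrix_vector_mult_def axis_def by (simp add: if_distrib cong: if_cong)
  then show ?thesis by simp
qed

lemma psd_diag_nonneg: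
  assumes "psd H"
  shows "0 \<le> Re (H $ q $ q)"
proof -
  have "0 \<le> Re (\<Sum>i\<in>UNIV. cnj (axis q 1 $ i) * (H *v axis q 1) $ i)"
    using assms unfolding psd_def by blast
  then show ?thesis by (simp only: quadratic_form_axis)
qed

lemma real_trace_pos:
  fixes H :: "complex^'d^'d"
  assumes "psd H" "H \<noteq> 0"
  shows "0 < real_trace H"
proof (rule ccontr)
  assume "\<not> 0 < real_trace H"
  moreover have tr: "real_trace H = (\<Sum>q\<in>UNIV. Re (H $ q $ q))"
    by (simp add: real_trace_def trace_def)
  moreover have "0 \<le> (\<Sum>q\<in>UNIV. Re (H $ q $ q))"
    by (rule sum_nonneg) (rule psd_diag_nonneg[OF assms(1)])
  ultimately have "(\<Sum>q\<in>UNIV. Re (H $ q $ q)) = 0"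
    by linarith
  then have diag: "Re (H $ q $ q) = 0" for q
    using psd_diag_nonneg[OF assms(1)] by (subst (asm) sum_nonneg_eq_0_iff) auto
  have herm: "H $ j $ i = cnj (H $ i $ j)" for i j
    using assms(1) conj_transpose_nth[of H j i] by (simp add: psd_def hermitian_def)
  have diag0: "H $ q $ q = 0" for q
    using diag[of q] herm[of q q] by (simp add: complex_eq_iff)
  have "H $ p $ q = 0" for p q
  proof (cases "p = q")
    case False
    define x :: "complex^'d" where
      "x = (\<chi> i. if i = p then - (H $ p $ q) else if i = q then 1 else 0)"
    have "0 \<le> Re (\<Sum>i\<in>UNIV. cnj (x $ i) * (H *v x) $ i)"
      using assms(1) by (simp add: psd_def)
    then have "0 \<le> - 2 * Re (H $ p $ q * cnj (H $ p $ q))"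
      by (simp add: quadratic_form_two_entries[OF False x_def] diag0 herm[of q p])
    moreover have "Re (H $ p $ q * cnj (H $ p $ q)) = (cmod (H $ p $ q))\<^sup>2"
      unfolding cmod_power2 by (simp add: power2_eq_square)
    ultimately have "(cmod (H $ p $ q))\<^sup>2 \<le> 0" by linarith
    then show ?thesis by simp
  qed (simp add: diag0)
  then show False using assms(2) by (simp add: vec_eq_iff)
qed

lemma pmf_index_pmf:
  fixes H :: "complex^'d^'d"
  assumes "psd H" "H \<noteq> 0"
  shows "pmf (index_pmf H) q = Re (H $ q $ q) / real_trace H"
  unfolding index_pmf_def
proof (rule pmf_embed_pmf)
  have pos: "0 < real_trace H" by (rule real_trace_pos[OF assms])
  show nn: "0 \<le> Re (H $ q $ q) / real_trace H" for q
    using pos psd_diag_nonneg[OF assms(1)] by simp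
  have "(\<Sum>q\<in>UNIV. Re (H $ q $ q) / real_trace H) = 1"
    using pos by (simp add: real_trace_def trace_def flip: sum_divide_distrib)
  then show "(\<integral>\<^sup>+ q. ennreal (Re (H $ q $ q) / real_trace H) \<partial>count_space UNIV) = 1"
    using nn by (simp add: nn_integral_count_space_finite sum_ennreal)
qed

end

theory Submission
  imports Defs
begin

text \<open>
  Put \<open>\<mu> = \<epsilon> / (2 t)\<close>. Since \<open>0 \<le> HN \<le> H\<close> for the Nystroem approximation \<open>HN = A B\<^sup>+ A\<^sup>*\<close>, the truncation
  error is at most \<open>\<epsilon> / 2\<close> by the choice of \<open>K\<close>, and by Duhamel's principle the dynamical error is at
  most \<open>t \<parallel>H - HN\<parallel>\<close>; so it suffices that \<open>H - HN \<le> \<mu>\<close> with probability at least \<open>1 - \<delta>\<close>.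

  Matrix concentration inequalities are avoided. The residual \<open>H - HN\<close> is dominated by the outcome of
  successively eliminating the sampled indices, \<open>R \<mapsto> R - R e\<^sub>q e\<^sub>q\<^sup>* R / R\<^sub>q\<^sub>q\<close>. As \<open>R\<^sub>q\<^sub>q \<le> H\<^sub>q\<^sub>q\<close>, one step
  with \<open>q\<close> drawn with probability \<open>H\<^sub>q\<^sub>q / Tr H\<close> has mean at most \<open>R - R\<^sup>2 / Tr H\<close>. Consequently the
  potential \<open>\<Sum> \<lambda> max 0 (\<lambda> - \<theta>)\<close> over the eigenvalues \<open>\<lambda>\<close> of \<open>R\<close> contracts in mean by the factor
  \<open>1 - \<theta> / Tr H\<close>. It is at most \<open>(Tr H)\<^sup>2\<close> initially and at least \<open>\<mu> (\<mu> - \<theta>)\<close> when some eigenvalue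
  exceeds \<open>\<mu>\<close>, so Markov's inequality with \<open>\<theta> = \<mu> / 2\<close> concludes.
\<close>

subsection \<open>Spectral theorem for Hermitian matrices\<close>

text \<open>Conjugate-linear in the first argument, so that \<open>\<bullet>\<close> is its real
  part: norms and quadratic forms can be treated with the real inner product, while orthogonality
  stays complex.\<close>

definition cinner :: "complex^'n \<Rightarrow> complex^'n \<Rightarrow> complex" where
  "cinner x y = (\<Sum>i\<in>UNIV. cnj (x $ i) * y $ i)"

lemma cinner_add_right: "cinner x (y + z) = cinner x y + cinner x z"
  and cinner_diff_right: "cinner x (y - z) = cinner x y - cinner x z"
  and cinner_scale_right: "cinner x (c *s y) = c * cinner x y"
  and cinner_scaleR_right: "cinner x (r *\<^sub>R y) = of_real r * cinner x y"
  and cinner_zero_right: "cinner x 0 = 0"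
  by (simp_all add: cinner_def algebra_simps sum.distrib sum_subtractf sum_distrib_left
      scaleR_conv_of_real[where 'a=complex])

lemma cinner_commute: "cinner y x = cnj (cinner x y)"
  by (simp add: cinner_def mult.commute)

lemma cinner_scale_left: "cinner (c *s x) z = cnj c * cinner x z"
  by (simp add: cinner_def sum_distrib_left mult.assoc)

lemma cinner_zero_left: "cinner 0 x = 0"
  by (simp add: cinner_def)

lemma cinner_sum_right: "cinner x (\<Sum>a\<in>S. f a) = (\<Sum>a\<in>S. cinner x (f a))"
  by (induction S rule: infinite_finite_induct) (simp_all add: cinner_zero_right cinner_add_right)

lemma Re_cinner: "Re (cinner x y) = x \<bullet> y"
  by (simp add: cinner_def inner_vec_def inner_complex_def)

lemma cinner_self: "cinner x x = of_real ((norm x)\<^sup>2)"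
proof -
  have "Im (cinner x x) = 0" by (simp add: cinner_def)
  then show ?thesis
    by (simp add: complex_eq_iff Re_cinner power2_norm_eq_inner)
qed

lemma cinner_axis_left: "cinner (axis q 1) x = x $ q"
proof -
  have "cnj (axis q 1 $ i) * x $ i = (if i = q then x $ q else 0)" for i
    by (simp add: axis_def)
  then show ?thesis by (simp add: cinner_def)
qed

lemma cinner_mult_right: "cinner x (X *v y) = cinner (conj_transpose X *v x) y"
  unfolding cinner_def matrix_vector_mult_def
  by (simp add: sum_distrib_left sum_distrib_right mult_ac, subst sum.swap) (rule refl)

lemma hermitian_cinner: "hermitian X \<Longrightarrow> cinner (X *v x) y = cinner x (X *v y)"
  by (simp add: cinner_mult_right hermitian_def)

text \<open>A zero of a nonnegative form is a minimum, hence stationary. Moving from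
  \<open>w\<close> to \<open>w - s *\<^sub>R f w\<close>, which stays in \<open>W\<close>, turns the
  form into \<open>- 2 s a + s\<^sup>2 b\<close> with
  \<open>a = \<parallel>f w\<parallel>\<^sup>2\<close>; this is negative for small positive
  \<open>s\<close> unless \<open>a = 0\<close>.\<close>

lemma selfadjoint_eq_zero_on_subspace:
  fixes f :: "'a::real_inner \<Rightarrow> 'a"
  assumes "linear f" and sym: "\<And>x y. x \<bullet> f y = f x \<bullet> y" and W: "subspace W"
    and nonneg: "\<And>x. x \<in> W \<Longrightarrow> 0 \<le> x \<bullet> f x"
    and w: "w \<in> W" "f w \<in> W" "w \<bullet> f w = 0"
  shows "f w = 0"
proof -
  define z where "z = f w"
  define a where "a = z \<bullet> z"
  define b where "b = z \<bullet> f z"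
  have b: "0 \<le> b" using nonneg w(2) by (simp add: b_def z_def)
  have *: "0 \<le> - (2 * s * a) + s\<^sup>2 * b" for s
  proof -
    have "0 \<le> (w - s *\<^sub>R z) \<bullet> f (w - s *\<^sub>R z)"
      using W w by (intro nonneg subspace_diff subspace_scale) (auto simp: z_def)
    also have "\<dots> = - (2 * s * a) + s\<^sup>2 * b"
      using w(3) sym[of w z] assms(1)
      by (simp add: linear_diff linear_scale a_def b_def z_def inner_diff_left inner_diff_right
          power2_eq_square algebra_simps)
    finally show ?thesis .
  qed
  have "a = 0"
  proof (rule ccontr)
    assume "a \<noteq> 0"
    then have a: "0 < a" by (simp add: a_def)
    \<comment> \<open>The denominator \<open>b + 1\<close> is positive even if \<open>b = 0\<close>,
      and with this step size the quadratic term is at most half of the linear one.\<close>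
    let ?s = "a / (b + 1)"
    have "?s * b \<le> a" using a b by (simp add: field_simps)
    then have "?s * (?s * b) \<le> ?s * a" using a b by (intro mult_left_mono) auto
    moreover have "0 < ?s * a" using a b by simp
    moreover have "?s * (?s * b) = ?s\<^sup>2 * b" by (simp add: power2_eq_square)
    ultimately show False using *[of ?s] by linarith
  qed
  then show ?thesis by (simp add: a_def z_def)
qed

text \<open>The Rayleigh quotient of a unit vector, hence the eigenvalue at a unit eigenvector. As a
  function of the vector it lets an eigenbasis be a plain set, with multiplicities counted by its
  members.\<close>

definition eigval :: "complex^'n^'n \<Rightarrow> complex^'n \<Rightarrow> real" where
  "eigval X u = u \<bullet> (X *v u)"

definition orthonormal :: "(complex^'n) set \<Rightarrow> bool" where
  "orthonormal E \<longleftrightarrow> finite E \<and> (\<forall>u\<in>E. \<forall>v\<in>E. cinner u v = (if u = v then 1 else 0))"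

definition eigenbasis :: "complex^'n^'n \<Rightarrow> (complex^'n) set \<Rightarrow> bool" where
  "eigenbasis X E \<longleftrightarrow> orthonormal E \<and> (\<forall>x. x = (\<Sum>u\<in>E. cinner u x *s u))
     \<and> (\<forall>u\<in>E. X *v u = of_real (eigval X u) *s u)"

lemma orthonormal_norm: "orthonormal E \<Longrightarrow> u \<in> E \<Longrightarrow> norm u = 1"
proof -
  assume "orthonormal E" "u \<in> E"
  then have "of_real ((norm u)\<^sup>2) = (1::complex)"
    by (simp add: orthonormal_def del: of_real_power flip: cinner_self)
  then have "(norm u)\<^sup>2 = 1" by (simp only: of_real_eq_1_iff)
  then show "norm u = 1" using norm_ge_zero[of u] unfolding power2_eq_1_iff by linarith
qed

text \<open>The bound is the real dimension, twice the complex one. It serves to make an orthonormal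
  set of eigenvectors of maximal cardinality exist.\<close>

lemma orthonormal_card_le:
  fixes E :: "(complex^'n) set"
  assumes "orthonormal E"
  shows "card E \<le> DIM(complex^'n)"
proof -
  have "pairwise orthogonal E"
    using assms by (auto simp: pairwise_def orthogonal_def orthonormal_def simp flip: Re_cinner)
  moreover have "0 \<notin> E" using orthonormal_norm[OF assms] by force
  ultimately have "independent E" by (rule pairwise_orthogonal_independent)
  then show ?thesis by (metis independent_bound)
qed

text \<open>The Rayleigh quotient attains its maximum on the unit sphere of \<open>W\<close> at some
  \<open>w\<close>. The operator \<open>eigval X w - X\<close> is then nonnegative on
  \<open>W\<close> with a form vanishing at \<open>w\<close>, so it annihilates
  \<open>w\<close>.\<close>

lemma eigenvector_in_invariant_subspace:
  fixes X :: "complex^'n^'n"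
  assumes X: "hermitian X" and W: "subspace W" "closed W" and x: "x \<in> W" "x \<noteq> 0"
    and inv: "\<And>y. y \<in> W \<Longrightarrow> X *v y \<in> W"
  obtains w where "w \<in> W" "norm w = 1" "X *v w = of_real (eigval X w) *s w"
proof -
  let ?K = "W \<inter> sphere 0 1"
  have "compact ?K" using W(2) by (simp add: closed_Int_compact)
  moreover have "(1 / norm x) *\<^sub>R x \<in> ?K"
    using x W(1) by (simp add: subspace_scale)
  moreover have "continuous_on ?K (\<lambda>x. x \<bullet> (X *v x))" by (intro continuous_intros)
  ultimately obtain w where w: "w \<in> ?K" and max: "\<And>y. y \<in> ?K \<Longrightarrow> y \<bullet> (X *v y) \<le> w \<bullet> (X *v w)"
    using continuous_attains_sup[of ?K "\<lambda>x. x \<bullet> (X *v x)"] by blast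
  define f where "f = (\<lambda>y. eigval X w *\<^sub>R y - X *v y)"
  have lin: "linear (\<lambda>y. X *v y)" using matrix_vector_mul_bounded_linear[of X] by (simp add: linear_conv_bounded_linear)
  have "f w = 0"
  proof (rule selfadjoint_eq_zero_on_subspace[where f = f and w = w, OF _ _ W(1)])
    show "linear f" unfolding f_def
      by (intro linear_compose_sub lin linear_compose_scale_right linear_ident)
    show "a \<bullet> f b = f a \<bullet> b" for a b
      using arg_cong[OF hermitian_cinner[OF X, of a b], of Re]
      by (simp add: f_def Re_cinner inner_diff_left inner_diff_right)
    show "0 \<le> a \<bullet> f a" if "a \<in> W" for a
    proof (cases "a = 0")
      case False
      let ?b = "(1 / norm a) *\<^sub>R a"
      have "?b \<in> ?K" using that W(1) False by (simp add: subspace_scale)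
      from max[OF this] have "?b \<bullet> (X *v ?b) \<le> eigval X w" by (simp add: eigval_def)
      moreover have "?b \<bullet> (X *v ?b) = (a \<bullet> (X *v a)) / (norm a)\<^sup>2"
        using linear_scale[OF lin, of "1 / norm a" a] by (simp add: power2_eq_square)
      ultimately have "(a \<bullet> (X *v a)) / (norm a)\<^sup>2 \<le> eigval X w" by linarith
      then have "a \<bullet> (X *v a) \<le> eigval X w * (norm a)\<^sup>2"
        using False by (simp add: divide_le_eq)
      then show ?thesis by (simp add: f_def inner_diff_right power2_norm_eq_inner)
    qed (simp add: f_def)
    show "w \<in> W" using w by simp
    show "f w \<in> W" using w inv W(1) by (simp add: f_def subspace_diff subspace_scale)
    have "w \<bullet> w = 1" using w by (simp add: dot_square_norm)
    then show "w \<bullet> f w = 0" using w by (simp add: f_def inner_diff_right eigval_def)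
  qed
  then have "X *v w = of_real (eigval X w) *s w"
    by (simp add: f_def vec_eq_iff scaleR_conv_of_real[where 'a=complex])
  with w show thesis by (intro that) auto
qed

text \<open>A maximal orthonormal set of eigenvectors is complete: its orthogonal complement is
  invariant, hence would contain a further eigenvector.\<close>

theorem eigenbasis_exists:
  fixes X :: "complex^'n^'n"
  assumes X: "hermitian X"
  shows "\<exists>E. eigenbasis X E"
proof -
  define P where "P E \<longleftrightarrow> orthonormal E \<and> (\<forall>u\<in>E. X *v u = of_real (eigval X u) *s u)" for E
  have "P {}" by (simp add: P_def orthonormal_def)
  moreover have "\<forall>E. P E \<longrightarrow> card E < Suc DIM(complex^'n)"
    using orthonormal_card_le unfolding P_def by fastforce
  ultimately obtain E where E: "P E" and max: "\<And>F. P F \<Longrightarrow> card F \<le> card E"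
    using ex_has_greatest_nat[of P "{}" card "Suc DIM(complex^'n)"] by (metis less_imp_le)
  then have fin: "finite E" and orth: "\<And>u v. u \<in> E \<Longrightarrow> v \<in> E \<Longrightarrow> cinner u v = (if u = v then 1 else 0)"
    and eig: "\<And>u. u \<in> E \<Longrightarrow> X *v u = of_real (eigval X u) *s u"
    by (auto simp: P_def orthonormal_def)
  define W where "W = {x. \<forall>u\<in>E. cinner u x = 0}"
  have W: "subspace W"
    by (auto simp: W_def subspace_def cinner_zero_right cinner_add_right cinner_scaleR_right)
  have "W = (\<Inter>u\<in>E. {x. cinner u x = 0})" by (auto simp: W_def)
  moreover have "closed {x. cinner u x = 0}" for u :: "complex^'n"
    unfolding cinner_def by (intro closed_Collect_eq continuous_intros)
  ultimately have cl: "closed W" by auto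
  have inv: "X *v y \<in> W" if "y \<in> W" for y
    unfolding W_def
  proof safe
    fix u assume "u \<in> E"
    then have "cinner u (X *v y) = cinner (of_real (eigval X u) *s u) y"
      using hermitian_cinner[OF X] eig by metis
    then show "cinner u (X *v y) = 0" using that \<open>u \<in> E\<close> by (simp add: cinner_scale_left W_def)
  qed
  have triv: "x = 0" if x: "x \<in> W" for x
  proof (rule ccontr)
    assume "x \<noteq> 0"
    then obtain w where w: "w \<in> W" "norm w = 1" "X *v w = of_real (eigval X w) *s w"
      using eigenvector_in_invariant_subspace[OF X W cl x _ inv] by blast
    have "cinner w w = 1" using w(2) by (simp add: cinner_self)
    moreover have "cinner u w = 0" "cinner w u = 0" if "u \<in> E" for u
      using w(1) that cinner_commute[of w u] by (auto simp: W_def)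
    moreover from calculation have "w \<notin> E" by force
    ultimately have "P (insert w E)"
      using E w(3) by (auto simp: P_def orthonormal_def)
    from max[OF this] show False using \<open>w \<notin> E\<close> fin by simp
  qed
  have "x = (\<Sum>u\<in>E. cinner u x *s u)" for x
  proof -
    have "cinner v (\<Sum>u\<in>E. cinner u x *s u) = cinner v x" if "v \<in> E" for v
    proof -
      have "cinner v (\<Sum>u\<in>E. cinner u x *s u) = (\<Sum>u\<in>E. if u = v then cinner v x else 0)"
        unfolding cinner_sum_right cinner_scale_right
        by (rule sum.cong) (auto simp: orth that)
      then show ?thesis using fin that by simp
    qed
    then have "x - (\<Sum>u\<in>E. cinner u x *s u) \<in> W" by (simp add: W_def cinner_diff_right)
    from triv[OF this] show ?thesis by simp
  qed
  then show ?thesis using E by (auto simp: eigenbasis_def P_def)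
qed

lemma eigenbasis_orthonormal: "eigenbasis X E \<Longrightarrow> orthonormal E"
  and eigenbasis_finite: "eigenbasis X E \<Longrightarrow> finite E"
  and eigenbasis_expansion: "eigenbasis X E \<Longrightarrow> (\<Sum>u\<in>E. cinner u x *s u) = x"
  and eigenbasis_eigval: "eigenbasis X E \<Longrightarrow> u \<in> E \<Longrightarrow> X *v u = of_real (eigval X u) *s u"
  by (auto simp: eigenbasis_def orthonormal_def)

lemma cinner_parseval:
  assumes "eigenbasis X E"
  shows "cinner x y = (\<Sum>u\<in>E. cnj (cinner u x) * cinner u y)"
proof -
  have "cinner x y = cinner x (\<Sum>u\<in>E. cinner u y *s u)"
    by (simp only: eigenbasis_expansion[OF assms])
  also have "\<dots> = (\<Sum>u\<in>E. cnj (cinner u x) * cinner u y)"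
    unfolding cinner_sum_right cinner_scale_right
    by (intro sum.cong refl) (simp add: mult.commute flip: cinner_commute)
  finally show ?thesis .
qed

lemma norm_parseval:
  assumes "eigenbasis X E"
  shows "(norm x)\<^sup>2 = (\<Sum>u\<in>E. (cmod (cinner u x))\<^sup>2)"
proof -
  have "(norm x)\<^sup>2 = Re (cinner x x)" by (simp add: Re_cinner power2_norm_eq_inner)
  also have "\<dots> = (\<Sum>u\<in>E. (cmod (cinner u x))\<^sup>2)"
    unfolding cinner_parseval[OF assms, of x x] Re_sum
    by (intro sum.cong refl, unfold cmod_power2) (simp add: power2_eq_square)
  finally show ?thesis .
qed

lemma eigenbasis_vec_eqI:
  assumes "eigenbasis X E" "\<And>u. u \<in> E \<Longrightarrow> cinner u x = cinner u y"
  shows "x = y"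
  by (metis (no_types, lifting) assms eigenbasis_expansion sum.cong)

section \<open>Functional calculus by the matrices \<open>\<Sum> f(u) u u\<^sup>*\<close> over an
  eigenbasis\<close>

definition spectral_sum :: "(complex^'n) set \<Rightarrow> (complex^'n \<Rightarrow> complex) \<Rightarrow> complex^'n^'n" where
  "spectral_sum E f = (\<chi> i j. \<Sum>u\<in>E. f u * u $ i * cnj (u $ j))"

lemma spectral_sum_mult_vec: "spectral_sum E f *v x = (\<Sum>u\<in>E. (f u * cinner u x) *s u)"
proof -
  have "(spectral_sum E f *v x) $ i = (\<Sum>u\<in>E. f u * cinner u x * u $ i)" for i
    unfolding spectral_sum_def matrix_vector_mult_def cinner_def
    by (simp add: sum_distrib_left sum_distrib_right, subst sum.swap)
      (simp add: mult_ac)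
  then show ?thesis by (simp add: vec_eq_iff)
qed

lemma cinner_spectral_sum:
  assumes "orthonormal E" "u \<in> E"
  shows "cinner u (spectral_sum E f *v x) = f u * cinner u x"
proof -
  have "cinner u (spectral_sum E f *v x) = (\<Sum>v\<in>E. if v = u then f u * cinner u x else 0)"
    unfolding spectral_sum_mult_vec cinner_sum_right cinner_scale_right
    using assms by (intro sum.cong) (auto simp: orthonormal_def)
  then show ?thesis using assms by (simp add: orthonormal_def)
qed

lemma spectral_sum_mult:
  assumes "eigenbasis X E"
  shows "spectral_sum E f ** spectral_sum E g = spectral_sum E (\<lambda>u. f u * g u)"
  unfolding matrix_eq
  by (intro allI eigenbasis_vec_eqI[OF assms])
    (simp add: cinner_spectral_sum eigenbasis_orthonormal[OF assms]
      flip: matrix_vector_mul_assoc)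

lemma spectral_sum_one: "eigenbasis X E \<Longrightarrow> spectral_sum E (\<lambda>_. 1) = mat 1"
  unfolding matrix_eq by (simp add: spectral_sum_mult_vec eigenbasis_expansion)

lemma spectral_sum_cong: "(\<And>u. u \<in> E \<Longrightarrow> f u = g u) \<Longrightarrow> spectral_sum E f = spectral_sum E g"
  by (simp add: spectral_sum_def)

lemma cinner_eigen:
  assumes "hermitian X" "eigenbasis X E" "u \<in> E"
  shows "cinner u (X *v x) = of_real (eigval X u) * cinner u x"
  using hermitian_cinner[OF assms(1), of u x] eigenbasis_eigval[OF assms(2,3)]
  by (simp add: cinner_scale_left)

lemma spectral_decomposition:
  assumes "hermitian X" "eigenbasis X E"
  shows "X = spectral_sum E (\<lambda>u. of_real (eigval X u))"
  unfolding matrix_eq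
  by (intro allI eigenbasis_vec_eqI[OF assms(2)])
    (simp add: cinner_spectral_sum cinner_eigen[OF assms] eigenbasis_orthonormal[OF assms(2)])

lemma matrix_pow_spectral_sum:
  assumes "eigenbasis X E"
  shows "matrix_pow (spectral_sum E f) k = spectral_sum E (\<lambda>u. f u ^ k)"
proof (induction k)
  case 0
  then show ?case by (simp add: matrix_pow_def spectral_sum_one[OF assms])
next
  case (Suc k)
  have "matrix_pow (spectral_sum E f) (Suc k) = spectral_sum E f ** matrix_pow (spectral_sum E f) k"
    by (simp add: matrix_pow_def)
  then show ?case by (simp add: Suc spectral_sum_mult[OF assms])
qed

lemma conj_transpose_mult: "conj_transpose (X ** Y) = conj_transpose Y ** conj_transpose X"
  by (simp add: vec_eq_iff matrix_matrix_mult_def mult.commute)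

lemma conj_transpose_conj_transpose: "conj_transpose (conj_transpose X) = X"
  by (simp add: vec_eq_iff)

lemma hermitian_spectral_sum:
  assumes "\<And>u. u \<in> E \<Longrightarrow> cnj (f u) = f u"
  shows "hermitian (spectral_sum E f)"
  using assms by (simp add: hermitian_def vec_eq_iff spectral_sum_def mult_ac)

lemma real_trace_eq_sum_eigval:
  assumes "hermitian X" "eigenbasis X E"
  shows "real_trace X = (\<Sum>u\<in>E. eigval X u)"
proof -
  have "trace X = trace (spectral_sum E (\<lambda>u. of_real (eigval X u)))"
    using spectral_decomposition[OF assms] by simp
  also have "\<dots> = (\<Sum>u\<in>E. of_real (eigval X u) * cinner u u)"
    by (simp add: trace_def spectral_sum_def cinner_def sum_distrib_left, subst sum.swap)
      (simp add: mult_ac)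
  also have "\<dots> = (\<Sum>u\<in>E. of_real (eigval X u))"
    using eigenbasis_orthonormal[OF assms(2)] by (intro sum.cong) (auto simp: orthonormal_def)
  finally show ?thesis by (simp add: real_trace_def)
qed

lemma norm_spectral_sum_le:
  assumes E: "eigenbasis X E" and C: "\<And>u. u \<in> E \<Longrightarrow> cmod (f u) \<le> C" and "0 \<le> C"
  shows "norm (spectral_sum E f *v x) \<le> C * norm x"
proof -
  have "(norm (spectral_sum E f *v x))\<^sup>2 = (\<Sum>u\<in>E. (cmod (f u))\<^sup>2 * (cmod (cinner u x))\<^sup>2)"
    unfolding norm_parseval[OF E]
    by (simp add: cinner_spectral_sum eigenbasis_orthonormal[OF E] norm_mult power_mult_distrib)
  also have "\<dots> \<le> (\<Sum>u\<in>E. C\<^sup>2 * (cmod (cinner u x))\<^sup>2)"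
    by (intro sum_mono mult_right_mono power_mono C) auto
  also have "\<dots> = (C * norm x)\<^sup>2"
    by (simp add: norm_parseval[OF E] power_mult_distrib sum_distrib_left)
  finally show ?thesis using \<open>0 \<le> C\<close> by (simp add: power2_le_iff_abs_le)
qed

section \<open>Quadratic forms of positive semidefinite matrices\<close>

lemma psd_iff: "psd X \<longleftrightarrow> hermitian X \<and> (\<forall>x. 0 \<le> x \<bullet> (X *v x))"
  unfolding psd_def by (simp only: flip: cinner_def Re_cinner)

lemma psd_hermitian: "psd X \<Longrightarrow> hermitian X"
  by (simp add: psd_def)

lemma psd_inner_nonneg: "psd X \<Longrightarrow> 0 \<le> x \<bullet> (X *v x)"
  by (simp add: psd_iff)

lemma eigval_nonneg: "psd X \<Longrightarrow> 0 \<le> eigval X u"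
  by (simp add: eigval_def psd_inner_nonneg)

lemma inner_hermitian: "hermitian X \<Longrightarrow> (X *v x) \<bullet> y = x \<bullet> (X *v y)"
  using arg_cong[OF hermitian_cinner[of X x y], of Re] by (simp add: Re_cinner)

lemma quadratic_form_eigen:
  assumes "hermitian X" "eigenbasis X E"
  shows "x \<bullet> (X *v x) = (\<Sum>u\<in>E. eigval X u * (cmod (cinner u x))\<^sup>2)"
proof -
  have "x \<bullet> (X *v x) = Re (\<Sum>u\<in>E. cnj (cinner u x) * (of_real (eigval X u) * cinner u x))"
    unfolding Re_cinner[symmetric] cinner_parseval[OF assms(2), of x "X *v x"]
    by (simp add: cinner_eigen[OF assms])
  also have "\<dots> = (\<Sum>u\<in>E. eigval X u * (cmod (cinner u x))\<^sup>2)"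
    unfolding Re_sum
    by (intro sum.cong refl, unfold cmod_power2) (simp add: power2_eq_square algebra_simps)
  finally show ?thesis .
qed

lemma psd_mult_eq_zero:
  assumes "psd X" "w \<bullet> (X *v w) = 0"
  shows "X *v w = 0"
proof (rule selfadjoint_eq_zero_on_subspace[where f = "\<lambda>x. X *v x" and W = UNIV and w = w])
  show "linear (\<lambda>x. X *v x)"
    using matrix_vector_mul_bounded_linear[of X] by (simp add: linear_conv_bounded_linear)
qed (use assms inner_hermitian[of X] in \<open>simp_all add: psd_iff\<close>)

subsection \<open>Pseudoinverse of a Hermitian matrix\<close>

text \<open>\<open>X Y\<close> and \<open>X Z\<close> are both the orthogonal projection onto the
  range of \<open>X\<close>, and \<open>Y X = Z X\<close> follows in the same way. Then
  \<open>Y = Y X Y = Y X Z = Z X Z = Z\<close>.\<close>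

lemma penrose_unique:
  assumes "X ** Y ** X = X" "Y ** X ** Y = Y" "hermitian (X ** Y)" "hermitian (Y ** X)"
    and "X ** Z ** X = X" "Z ** X ** Z = Z" "hermitian (X ** Z)" "hermitian (Z ** X)"
  shows "Y = Z"
proof -
  have "X ** Y = conj_transpose ((X ** Z) ** (X ** Y))"
    using assms(3,5) by (simp add: hermitian_def matrix_mul_assoc)
  also have "\<dots> = (X ** Y) ** (X ** Z)"
    using assms(3,7) by (simp add: conj_transpose_mult[of "X ** Z"] hermitian_def)
  also have "\<dots> = X ** Z" using assms(1) by (simp add: matrix_mul_assoc)
  finally have XY: "X ** Y = X ** Z" .
  have "Y ** X = conj_transpose ((Y ** X) ** (Z ** X))"
    using assms(4,5) by (metis hermitian_def matrix_mul_assoc)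
  also have "\<dots> = (Z ** X) ** (Y ** X)"
    using assms(4,8) by (simp add: conj_transpose_mult[of "Y ** X"] hermitian_def)
  also have "\<dots> = Z ** X" using assms(1) by (metis matrix_mul_assoc)
  finally have YX: "Y ** X = Z ** X" .
  show ?thesis using assms(2,6) XY YX by (metis matrix_mul_assoc)
qed

lemma pseudoinverse_eqI:
  assumes "X ** Y ** X = X" "Y ** X ** Y = Y" "hermitian (X ** Y)" "hermitian (Y ** X)"
  shows "pseudoinverse X = Y"
  unfolding pseudoinverse_def
  by (rule the_equality) (use assms penrose_unique in blast)+

lemma pseudoinverse_hermitian:
  assumes "hermitian X"
  shows "X ** pseudoinverse X ** X = X"
    and "pseudoinverse X ** X ** pseudoinverse X = pseudoinverse X"
    and "pseudoinverse X ** X = X ** pseudoinverse X"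
    and "hermitian (pseudoinverse X)"
proof -
  obtain E where E: "eigenbasis X E" using eigenbasis_exists[OF assms] by blast
  \<comment> \<open>Inverts the nonzero eigenvalues; the convention \<open>inverse 0 = 0\<close>
    takes care of the kernel.\<close>
  define Y where "Y = spectral_sum E (\<lambda>u. inverse (of_real (eigval X u)))"
  have X: "X = spectral_sum E (\<lambda>u. of_real (eigval X u))" by (rule spectral_decomposition[OF assms E])
  have XY: "X ** Y = spectral_sum E (\<lambda>u. of_real (eigval X u) * inverse (of_real (eigval X u)))"
    using spectral_sum_mult[OF E] X unfolding Y_def by metis
  have comm: "Y ** X = X ** Y"
    unfolding XY using spectral_sum_mult[OF E] X unfolding Y_def
    by (metis (no_types, lifting) mult.commute spectral_sum_cong)
  have inv: "z * inverse z * z = z" "z * inverse z * inverse z = inverse z" for z :: complex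
    by (cases "z = 0"; simp)+
  have "X ** Y ** X = spectral_sum E
      (\<lambda>u. of_real (eigval X u) * inverse (of_real (eigval X u)) * of_real (eigval X u))"
    unfolding XY using spectral_sum_mult[OF E] X by metis
  also have "\<dots> = spectral_sum E (\<lambda>u. of_real (eigval X u))"
    by (simp only: inv)
  finally have XYX: "X ** Y ** X = X" by (simp flip: X)
  have "Y ** X ** Y = spectral_sum E (\<lambda>u. inverse (of_real (eigval X u)))"
    unfolding comm XY unfolding Y_def spectral_sum_mult[OF E]
    by (simp only: inv)
  then have YXY: "Y ** X ** Y = Y" by (simp add: Y_def)
  have "hermitian (X ** Y)"
    unfolding XY by (rule hermitian_spectral_sum) simp
  then have "pseudoinverse X = Y" using XYX YXY comm by (intro pseudoinverse_eqI) auto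
  moreover have "hermitian Y" unfolding Y_def by (rule hermitian_spectral_sum) simp
  ultimately show "X ** pseudoinverse X ** X = X"
    and "pseudoinverse X ** X ** pseudoinverse X = pseudoinverse X"
    and "pseudoinverse X ** X = X ** pseudoinverse X"
    and "hermitian (pseudoinverse X)" using XYX YXY comm by auto
qed

subsection \<open>Elimination and the Nystroem residual\<close>

lemma inner_mult_right: "x \<bullet> (X *v y) = (conj_transpose X *v x) \<bullet> y"
  using arg_cong[OF cinner_mult_right[of x X y], of Re] by (simp add: Re_cinner)

lemma hermitian_nth: "hermitian X \<Longrightarrow> cnj (X $ i $ j) = X $ j $ i"
  using conj_transpose_nth[of X j i] by (simp add: hermitian_def)

lemma hermitian_diag_real: "hermitian X \<Longrightarrow> X $ q $ q = of_real (Re (X $ q $ q))"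
  using hermitian_nth[of X q q] by (simp add: complex_eq_iff)

text \<open>One step of symmetric Gaussian elimination, that is, a Schur complement kept at full
  size. If the diagonal entry is \<open>0\<close>, division by zero gives \<open>0\<close> and
  \<open>R\<close> is left unchanged.\<close>

definition pivot :: "complex^'n^'n \<Rightarrow> 'n \<Rightarrow> complex^'n^'n" where
  "pivot R q = (\<chi> i j. R $ i $ j - R $ i $ q * R $ q $ j / R $ q $ q)"

lemma mult_axis: "R *v axis q 1 = (\<chi> i. R $ i $ q)" for R :: "complex^'n^'m"
proof -
  have "R $ i $ j * axis q 1 $ j = (if j = q then R $ i $ q else 0)" for i j
    by (simp add: axis_def)
  then show ?thesis by (simp add: vec_eq_iff matrix_vector_mult_def)
qed

lemma axis_inner_mult: "axis q 1 \<bullet> (R *v axis q 1) = Re (R $ q $ q)"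
  by (simp add: cinner_axis_left mult_axis flip: Re_cinner)

lemma pivot_mult_vec:
  "pivot R q *v x = R *v (x - ((R *v x) $ q / R $ q $ q) *s axis q 1)"
proof -
  have "(pivot R q *v x) $ i = (R *v x) $ i - (R *v x) $ q / R $ q $ q * R $ i $ q" for i
    by (simp add: pivot_def matrix_vector_mult_def sum_subtractf algebra_simps
        sum_distrib_left sum_divide_distrib)
  then show ?thesis
    by (simp add: vec_eq_iff matrix_vector_mult_diff_distrib vector_scalar_commute mult_axis)
qed

lemma pivot_form:
  assumes R: "psd R"
  shows "x \<bullet> (pivot R q *v x) = x \<bullet> (R *v x) - (cmod ((R *v x) $ q))\<^sup>2 / Re (R $ q $ q)"
proof -
  define c where "c = (R *v x) $ q / R $ q $ q"
  have "cinner x (R *v axis q 1) = cnj ((R *v x) $ q)"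
    using hermitian_cinner[OF psd_hermitian[OF R], of x "axis q 1"]
    by (metis cinner_axis_left cinner_commute)
  then have "cinner x (pivot R q *v x) = cinner x (R *v x) - c * cnj ((R *v x) $ q)"
    by (simp add: pivot_mult_vec c_def matrix_vector_mult_diff_distrib vector_scalar_commute
        cinner_diff_right cinner_scale_right)
  moreover have "c * cnj ((R *v x) $ q) = of_real ((cmod ((R *v x) $ q))\<^sup>2 / Re (R $ q $ q))"
    unfolding c_def of_real_divide complex_norm_square
    by (subst (1) hermitian_diag_real[OF psd_hermitian[OF R]]) simp
  ultimately have "cinner x (pivot R q *v x)
    = cinner x (R *v x) - of_real ((cmod ((R *v x) $ q))\<^sup>2 / Re (R $ q $ q))" by simp
  from arg_cong[OF this, of Re] show ?thesis
    by (simp only: minus_complex.sel Re_cinner Re_complex_of_real)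
qed

text \<open>The coefficient makes entry \<open>q\<close> of \<open>R\<close> applied to the shifted
  vector vanish, so the shift is orthogonal to that image; if \<open>R\<^sub>q\<^sub>q = 0\<close>
  the shift itself is zero. Positivity of the pivoted matrix can be read off from this form.\<close>

lemma pivot_form_shift:
  assumes R: "psd R"
  shows "x \<bullet> (pivot R q *v x) = (x - ((R *v x) $ q / R $ q $ q) *s axis q 1)
    \<bullet> (R *v (x - ((R *v x) $ q / R $ q $ q) *s axis q 1))"
proof -
  define c where "c = (R *v x) $ q / R $ q $ q"
  have "cinner (c *s axis q 1) (R *v (x - c *s axis q 1)) = 0"
    by (simp add: c_def cinner_scale_left cinner_axis_left matrix_vector_mult_diff_distrib
        vector_scalar_commute mult_axis)
  then have "(c *s axis q 1) \<bullet> (R *v (x - c *s axis q 1)) = 0"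
    by (simp flip: Re_cinner)
  then show ?thesis
    unfolding pivot_mult_vec c_def[symmetric] by (simp add: inner_diff_left)
qed

lemma psd_pivot:
  assumes R: "psd R"
  shows "psd (pivot R q)"
  unfolding psd_iff
proof safe
  show "hermitian (pivot R q)"
    using hermitian_nth[OF psd_hermitian[OF R]]
    by (simp add: hermitian_def vec_eq_iff pivot_def mult.commute)
  show "0 \<le> x \<bullet> (pivot R q *v x)" for x
    unfolding pivot_form_shift[OF R] by (rule psd_inner_nonneg[OF R])
qed

lemma pivot_le:
  assumes R: "psd R"
  shows "x \<bullet> (pivot R q *v x) \<le> x \<bullet> (R *v x)"
  unfolding pivot_form[OF R] using psd_diag_nonneg[OF R] by simp

text \<open>The head of the list is eliminated last, so an induction on the list adds the most
  recent draw on the outside.\<close>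

fun residual :: "complex^'n^'n \<Rightarrow> 'n list \<Rightarrow> complex^'n^'n" where
  "residual H [] = H"
| "residual H (q # qs) = pivot (residual H qs) q"

lemma psd_residual: "psd H \<Longrightarrow> psd (residual H qs)"
  by (induction qs) (auto simp: psd_pivot)

lemma residual_le: "psd H \<Longrightarrow> x \<bullet> (residual H qs *v x) \<le> x \<bullet> (H *v x)"
  by (induction qs) (auto intro: order_trans pivot_le psd_residual)

text \<open>The shifts of the single elimination steps add up to one vector supported on the
  eliminated indices. This is what makes elimination comparable with the Nystroem residual, which
  minimises over all such shifts.\<close>

lemma residual_form_shift:
  assumes "psd H"
  shows "\<exists>z. (\<forall>i. i \<notin> set qs \<longrightarrow> z $ i = 0) \<and> x \<bullet> (residual H qs *v x) = (x - z) \<bullet> (H *v (x - z))"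
proof (induction qs arbitrary: x)
  case Nil
  show ?case by (rule exI[of _ 0]) simp
next
  case (Cons q qs)
  let ?R = "residual H qs"
  define w where "w = ((?R *v x) $ q / ?R $ q $ q) *s axis q (1::complex)"
  obtain z where "\<forall>i. i \<notin> set qs \<longrightarrow> z $ i = 0"
    "(x - w) \<bullet> (?R *v (x - w)) = (x - w - z) \<bullet> (H *v (x - w - z))"
    using Cons by blast
  moreover have "x \<bullet> (residual H (q # qs) *v x) = (x - w) \<bullet> (?R *v (x - w))"
    using pivot_form_shift[OF psd_residual[OF assms]] by (simp add: w_def)
  moreover have "w $ i = 0" if "i \<noteq> q" for i using that by (simp add: w_def axis_def)
  ultimately show ?case by (intro exI[of _ "w + z"]) (auto simp: algebra_simps)
qed

section \<open>The Nystroem residual as a minimum over shifts supported on the sample\<close>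

definition nystroem_H :: "complex^'d^'d \<Rightarrow> ('m::finite \<Rightarrow> 'd) \<Rightarrow> complex^'d^'d" where
  "nystroem_H H \<tau> = nystroem_A H \<tau> ** pseudoinverse (nystroem_B H \<tau>) ** conj_transpose (nystroem_A H \<tau>)"

text \<open>Column \<open>j\<close> is the unit vector at \<open>\<tau> j\<close>, so
  \<open>A = H S\<close> and \<open>B = S\<^sup>* H S\<close>. Repeated indices give repeated
  columns, and \<open>B\<close> may be singular.\<close>

definition selection :: "('m \<Rightarrow> 'd) \<Rightarrow> complex^'m^'d" where
  "selection \<tau> = (\<chi> i j. if i = \<tau> j then 1 else 0)"

lemma selection_mult_outside: "i \<notin> range \<tau> \<Longrightarrow> (selection \<tau> *v y) $ i = 0"
  by (auto simp: selection_def matrix_vector_mult_def intro!: sum.neutral)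

lemma conj_transpose_selection_mult: "(conj_transpose (selection \<tau>) *v x) $ j = x $ \<tau> j"
proof -
  have "cnj (selection \<tau> $ i $ j) * x $ i = (if i = \<tau> j then x $ \<tau> j else 0)" for i
    by (simp add: selection_def)
  then show ?thesis by (simp add: matrix_vector_mult_def)
qed

lemma nystroem_A_eq: "nystroem_A H \<tau> = H ** selection \<tau>"
proof -
  have "H $ i $ k * selection \<tau> $ k $ j = (if k = \<tau> j then H $ i $ \<tau> j else 0)" for i j k
    by (simp add: selection_def)
  then show ?thesis by (simp add: vec_eq_iff nystroem_A_def matrix_matrix_mult_def)
qed

lemma nystroem_B_eq: "nystroem_B H \<tau> = conj_transpose (selection \<tau>) ** (H ** selection \<tau>)"
  unfolding matrix_eq matrix_vector_mul_assoc[symmetric] nystroem_A_eq[symmetric]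
  by (simp only: vec_eq_iff conj_transpose_selection_mult)
    (simp add: nystroem_A_def nystroem_B_def matrix_vector_mult_def)

context
  fixes H :: "complex^'d^'d" and \<tau> :: "'m::finite \<Rightarrow> 'd"
  assumes H: "psd H"
begin

private abbreviation "S \<equiv> selection \<tau>"
private abbreviation "A \<equiv> nystroem_A H \<tau>"
private abbreviation "B \<equiv> nystroem_B H \<tau>"
private abbreviation "Y \<equiv> pseudoinverse (nystroem_B H \<tau>)"

lemma nystroem_B_form: "y \<bullet> (B *v y) = (S *v y) \<bullet> (H *v (S *v y))"
  by (simp add: nystroem_B_eq inner_mult_right[of y] conj_transpose_conj_transpose
      flip: matrix_vector_mul_assoc)

lemma hermitian_nystroem_B: "hermitian B"
  using hermitian_nth[OF psd_hermitian[OF H]]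
  by (simp add: hermitian_def vec_eq_iff nystroem_B_def)

lemmas pinv_B = pseudoinverse_hermitian[OF hermitian_nystroem_B]

text \<open>The range of \<open>A\<^sup>*\<close> is contained in that of \<open>B\<close>, because \<open>B y = 0\<close> forces \<open>H S y = 0\<close>.\<close>

lemma nystroem_A_pinv: "A ** Y ** B = A"
proof -
  have "A *v (Y ** B *v y - y) = 0" for y
  proof -
    let ?w = "Y ** B *v y - y"
    have "B *v ?w = 0"
      using pinv_B(1) by (simp add: matrix_vector_mult_diff_distrib matrix_vector_mul_assoc matrix_mul_assoc)
    then have "(S *v ?w) \<bullet> (H *v (S *v ?w)) = 0"
      by (simp flip: nystroem_B_form)
    from psd_mult_eq_zero[OF H this] show ?thesis
      by (simp add: nystroem_A_eq flip: matrix_vector_mul_assoc)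
  qed
  then show ?thesis
    unfolding matrix_eq
    by (simp add: matrix_vector_mult_diff_distrib matrix_vector_mul_assoc matrix_mul_assoc)
qed

lemma nystroem_pinv_A: "B ** Y ** conj_transpose A = conj_transpose A"
proof -
  have "conj_transpose (A ** (Y ** B)) = B ** Y ** conj_transpose A"
    using pinv_B(4) hermitian_nystroem_B
    by (simp add: conj_transpose_mult hermitian_def del: conj_transpose_nth)
  then show ?thesis by (simp add: nystroem_A_pinv matrix_mul_assoc)
qed

lemma hermitian_nystroem_H: "hermitian (nystroem_H H \<tau>)"
  using pinv_B(4)
  by (simp add: hermitian_def nystroem_H_def conj_transpose_mult conj_transpose_conj_transpose matrix_mul_assoc)

lemma psd_nystroem_H: "psd (nystroem_H H \<tau>)"
  unfolding psd_iff
proof safe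
  show "hermitian (nystroem_H H \<tau>)" by (rule hermitian_nystroem_H)
  show "0 \<le> x \<bullet> (nystroem_H H \<tau> *v x)" for x
  proof -
    define y where "y = conj_transpose A *v x"
    have "x \<bullet> (nystroem_H H \<tau> *v x) = y \<bullet> (Y *v y)"
      by (simp add: nystroem_H_def y_def inner_mult_right[of x A] flip: matrix_vector_mul_assoc)
    \<comment> \<open>By \<open>Y = Y B Y\<close> the form of \<open>Y\<close> at \<open>y\<close>
      becomes the form of \<open>B\<close> at \<open>Y y\<close>, which is a value of the form of
      \<open>H\<close>.\<close>
    also have "\<dots> = y \<bullet> (Y *v (B *v (Y *v y)))"
      using pinv_B(2) by (simp add: matrix_vector_mul_assoc matrix_mul_assoc)
    also have "\<dots> = (Y *v y) \<bullet> (B *v (Y *v y))"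
      using inner_hermitian[OF pinv_B(4)] by simp
    also have "\<dots> \<ge> 0" unfolding nystroem_B_form by (rule psd_inner_nonneg[OF H])
    finally show ?thesis .
  qed
qed

lemma nystroem_residual_mult:
  "(H - nystroem_H H \<tau>) *v x = H *v (x - S *v (Y *v (conj_transpose A *v x)))"
  by (simp add: nystroem_H_def matrix_vector_mult_diff_distrib matrix_vector_mult_diff_rdistrib
      nystroem_A_eq matrix_vector_mul_assoc matrix_mul_assoc)

text \<open>These are the normal equations of the projection: \<open>S\<^sup>* H S Y A\<^sup>* = B Y
  A\<^sup>* = A\<^sup>* = S\<^sup>* H\<close>.\<close>

lemma nystroem_residual_range: "((H - nystroem_H H \<tau>) *v x) $ \<tau> j = 0"
proof -
  let ?w = "Y *v (conj_transpose A *v x)"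
  have "conj_transpose S *v (H *v (S *v ?w)) = conj_transpose A *v x"
    using nystroem_pinv_A by (simp add: matrix_vector_mul_assoc matrix_mul_assoc nystroem_B_eq)
  moreover have "conj_transpose A *v x = conj_transpose S *v (H *v x)"
    using psd_hermitian[OF H]
    by (simp add: nystroem_A_eq conj_transpose_mult hermitian_def matrix_vector_mul_assoc)
  ultimately have "conj_transpose S *v ((H - nystroem_H H \<tau>) *v x) = 0"
    by (simp add: nystroem_residual_mult matrix_vector_mult_diff_distrib)
  then show ?thesis by (metis conj_transpose_selection_mult zero_index)
qed

lemma inner_nystroem_residual_range:
  assumes "\<And>i. i \<notin> range \<tau> \<Longrightarrow> z $ i = 0"
  shows "z \<bullet> ((H - nystroem_H H \<tau>) *v x) = 0"
  unfolding inner_vec_def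
proof (rule sum.neutral, safe)
  fix i
  show "z $ i \<bullet> ((H - nystroem_H H \<tau>) *v x) $ i = 0"
    using assms nystroem_residual_range by (cases "i \<in> range \<tau>") auto
qed

text \<open>Pythagoras in the semi-inner product of \<open>H\<close>: the vector
  \<open>S Y A\<^sup>* x\<close> projects \<open>x\<close> onto the vectors supported on the sample,
  and the cross term vanishes because \<open>d\<close> has its support there.\<close>

lemma nystroem_residual_minimal:
  assumes z: "\<And>i. i \<notin> range \<tau> \<Longrightarrow> z $ i = 0"
  shows "x \<bullet> ((H - nystroem_H H \<tau>) *v x) \<le> (x - z) \<bullet> (H *v (x - z))"
proof -
  define d where "d = S *v (Y *v (conj_transpose A *v x)) - z"
  define y where "y = x - S *v (Y *v (conj_transpose A *v x))"
  have Hy: "H *v y = (H - nystroem_H H \<tau>) *v x" by (simp add: nystroem_residual_mult y_def)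
  have dy: "d \<bullet> (H *v y) = 0"
    unfolding Hy by (rule inner_nystroem_residual_range) (simp add: d_def z selection_mult_outside)
  have yy: "y \<bullet> (H *v y) = x \<bullet> (H *v y)"
    unfolding Hy unfolding y_def inner_diff_left
    by (simp add: inner_nystroem_residual_range selection_mult_outside)
  have "(x - z) \<bullet> (H *v (x - z)) = (y + d) \<bullet> (H *v (y + d))" by (simp add: y_def d_def)
  also have "\<dots> = x \<bullet> (H *v y) + d \<bullet> (H *v d)"
    using dy yy inner_hermitian[OF psd_hermitian[OF H], of y d]
    by (simp add: matrix_vector_right_distrib inner_add_left inner_add_right inner_commute)
  finally show ?thesis using psd_inner_nonneg[OF H, of d] by (simp add: Hy)
qed

lemma psd_nystroem_residual: "psd (H - nystroem_H H \<tau>)"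
  unfolding psd_iff
proof safe
  show "hermitian (H - nystroem_H H \<tau>)"
    using psd_hermitian[OF H] hermitian_nystroem_H
    by (simp add: hermitian_def vec_eq_iff)
  show "0 \<le> x \<bullet> ((H - nystroem_H H \<tau>) *v x)" for x
  proof -
    \<comment> \<open>Replacing \<open>x\<close> by \<open>y\<close> on the left changes it only on
      the sample, where the residual vanishes; the form thus equals that of \<open>H\<close> at
      \<open>y\<close>.\<close>
    define y where "y = x - S *v (Y *v (conj_transpose A *v x))"
    have "y \<bullet> ((H - nystroem_H H \<tau>) *v x) = x \<bullet> ((H - nystroem_H H \<tau>) *v x)"
      unfolding y_def inner_diff_left
      by (simp add: inner_nystroem_residual_range selection_mult_outside)
    then show ?thesis
      using psd_inner_nonneg[OF H, of y] by (simp add: nystroem_residual_mult y_def)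
  qed
qed

text \<open>Elimination produces one admissible shift, whereas the Nystroem residual is optimal
  among them. This covers repeated indices and any order of elimination.\<close>

lemma nystroem_residual_le_residual:
  assumes "set qs \<subseteq> range \<tau>"
  shows "x \<bullet> ((H - nystroem_H H \<tau>) *v x) \<le> x \<bullet> (residual H qs *v x)"
proof -
  obtain z where "\<forall>i. i \<notin> set qs \<longrightarrow> z $ i = 0"
    "x \<bullet> (residual H qs *v x) = (x - z) \<bullet> (H *v (x - z))"
    using residual_form_shift[OF H] by blast
  then show ?thesis using assms by (metis nystroem_residual_minimal subsetD)
qed

end

subsection \<open>Unitary evolution\<close>

lemma norm_vector_scale: "norm (c *s x) = cmod c * norm x" for x :: "complex^'n"
  by (simp add: norm_vec_def norm_mult L2_set_right_distrib)

lemma bounded_linear_scale_vector: "bounded_linear (\<lambda>c. c *s u)" for u :: "complex^'n"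
  unfolding linear_conv_bounded_linear[symmetric]
  by (rule linearI) (simp_all add: vec_eq_iff algebra_simps)

lemma matrix_scale_spectral_sum: "matrix_scale c (spectral_sum E f) = spectral_sum E (\<lambda>u. c * f u)"
  by (simp add: matrix_scale_def map_matrix_def spectral_sum_def vec_eq_iff sum_distrib_left mult_ac)

lemma spectral_sum_sum: "(\<Sum>k\<in>K. spectral_sum E (f k)) = spectral_sum E (\<lambda>u. \<Sum>k\<in>K. f k u)"
  by (simp add: spectral_sum_def vec_eq_iff sum_distrib_right sum.swap[of _ E])

lemma sums_spectral_sum:
  assumes "\<And>u. u \<in> E \<Longrightarrow> (\<lambda>k. f k u) sums g u"
  shows "(\<lambda>k. spectral_sum E (f k)) sums spectral_sum E g"
  using assms unfolding sums_def spectral_sum_sum unfolding spectral_sum_def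
  by (intro tendsto_intros) auto

lemma matrix_exp_spectral_sum:
  assumes "eigenbasis X E"
  shows "matrix_exp (spectral_sum E f) = spectral_sum E (\<lambda>u. exp (f u))"
proof -
  have "(\<lambda>k. spectral_sum E (\<lambda>u. 1 / fact k * f u ^ k)) sums spectral_sum E (\<lambda>u. exp (f u))"
    using exp_converges[of "f u" for u]
    by (intro sums_spectral_sum) (simp add: scaleR_conv_of_real inverse_eq_divide)
  then show ?thesis
    unfolding matrix_exp_def
    by (simp add: matrix_pow_spectral_sum[OF assms] matrix_scale_spectral_sum sums_unique[symmetric])
qed

lemma evolved_state_spectral:
  assumes "hermitian X" "eigenbasis X E"
  shows "evolved_state X \<psi> t = spectral_sum E (\<lambda>u. exp (\<i> * of_real (t * eigval X u))) *v \<psi>"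
proof -
  have "matrix_scale (\<i> * of_real t) X = spectral_sum E (\<lambda>u. \<i> * of_real (t * eigval X u))"
    by (subst spectral_decomposition[OF assms]) (simp add: matrix_scale_spectral_sum mult_ac)
  then show ?thesis
    by (simp add: evolved_state_def matrix_exp_spectral_sum[OF assms(2)])
qed

lemma evolved_state_zero:
  assumes "hermitian X"
  shows "evolved_state X \<psi> 0 = \<psi>"
proof -
  obtain E where E: "eigenbasis X E" using eigenbasis_exists[OF assms] by blast
  show ?thesis by (simp add: evolved_state_spectral[OF assms E] spectral_sum_one[OF E])
qed

lemma norm_evolved_state_le:
  assumes "hermitian X"
  shows "norm (evolved_state X \<psi> t) \<le> norm \<psi>"
proof -
  obtain E where E: "eigenbasis X E" using eigenbasis_exists[OF assms] by blast
  show ?thesis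
    using norm_spectral_sum_le[OF E, of "\<lambda>u. exp (\<i> * of_real (t * eigval X u))" 1 \<psi>]
    by (simp add: evolved_state_spectral[OF assms E])
qed

lemma evolved_state_neg_inverse:
  assumes "hermitian X"
  shows "evolved_state X (evolved_state X \<psi> (- t)) t = \<psi>"
proof -
  obtain E where E: "eigenbasis X E" using eigenbasis_exists[OF assms] by blast
  have "exp (\<i> * of_real (t * l)) * exp (\<i> * of_real (- t * l)) = 1" for l
    by (simp add: exp_minus)
  then show ?thesis
    by (simp only: evolved_state_spectral[OF assms E] matrix_vector_mul_assoc
        spectral_sum_mult[OF E] spectral_sum_one[OF E] matrix_vector_mul_lid)
qed

lemma inner_evolved_state:
  assumes "hermitian X"
  shows "evolved_state X x (- t) \<bullet> y = x \<bullet> evolved_state X y t"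
proof -
  obtain E where E: "eigenbasis X E" using eigenbasis_exists[OF assms] by blast
  have "cnj (exp (\<i> * of_real (- t * l)) * z) * w = cnj z * (exp (\<i> * of_real (t * l)) * w)"
    for l z w by (simp add: exp_cnj)
  then have "cinner (evolved_state X x (- t)) y = cinner x (evolved_state X y t)"
    unfolding cinner_parseval[OF E, of "evolved_state X x (- t)"] cinner_parseval[OF E, of x]
    unfolding evolved_state_spectral[OF assms E]
    by (intro sum.cong refl) (simp only: cinner_spectral_sum eigenbasis_orthonormal[OF E])
  then show ?thesis by (simp flip: Re_cinner)
qed

lemma evolved_state_has_vector_derivative:
  assumes "hermitian X"
  shows "((\<lambda>r. evolved_state X x r) has_vector_derivative \<i> *s (X *v evolved_state X x t)) (at t)"
proof -
  obtain E where E: "eigenbasis X E" using eigenbasis_exists[OF assms] by blast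
  let ?c = "\<lambda>u r. exp (\<i> * of_real r * of_real (eigval X u)) * cinner u x"
  have ev: "evolved_state X x r = (\<Sum>u\<in>E. ?c u r *s u)" for r
    by (simp add: evolved_state_spectral[OF assms E] spectral_sum_mult_vec mult.assoc)
  have "(?c u has_vector_derivative \<i> * of_real (eigval X u) * ?c u t) (at t)" for u
    by (rule has_vector_derivative_real_field[of "\<lambda>z. exp (\<i> * z * of_real (eigval X u)) * cinner u x"])
      (auto intro!: derivative_eq_intros)
  then have "((\<lambda>r. \<Sum>u\<in>E. ?c u r *s u) has_vector_derivative
      (\<Sum>u\<in>E. (\<i> * of_real (eigval X u) * ?c u t) *s u)) (at t)"
    by (intro has_vector_derivative_sum
        bounded_linear.has_vector_derivative[OF bounded_linear_scale_vector])
  moreover have "(\<Sum>u\<in>E. (\<i> * of_real (eigval X u) * ?c u t) *s u)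
      = spectral_sum E (\<lambda>u. \<i> * of_real (eigval X u) * exp (\<i> * of_real (t * eigval X u))) *v x"
    by (simp add: spectral_sum_mult_vec mult.assoc)
  moreover have "\<dots> = \<i> *s (X *v evolved_state X x t)"
    by (rule eigenbasis_vec_eqI[OF E])
      (simp add: cinner_scale_right cinner_eigen[OF assms E] evolved_state_spectral[OF assms E]
        cinner_spectral_sum eigenbasis_orthonormal[OF E] mult.assoc)
  ultimately show ?thesis by (simp add: ev)
qed

text \<open>Duhamel's principle, tested against a vector: the derivative of
  \<open>\<langle>exp(i r X) a, exp(i r Z) \<psi>\<rangle>\<close> only sees the difference of the generators.\<close>

lemma norm_evolved_state_diff_le:
  assumes X: "hermitian X" and Z: "hermitian Z" and "0 \<le> t"
    and diff: "\<And>x. norm ((Z - X) *v x) \<le> \<Delta> * norm x"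
  shows "norm (evolved_state Z \<psi> t - evolved_state X \<psi> t) \<le> t * \<Delta> * norm \<psi>"
proof -
  define y where "y = evolved_state Z \<psi> t - evolved_state X \<psi> t"
  \<comment> \<open>The test vector is the error \<open>y\<close> itself, transported back in time,
    so that \<open>h t - h 0\<close> equals \<open>\<parallel>y\<parallel>\<^sup>2\<close>.\<close>
  define a where "a = evolved_state X y (- t)"
  define h where "h r = evolved_state X a r \<bullet> evolved_state Z \<psi> r" for r
  define h' where "h' r = evolved_state X a r \<bullet> (\<i> *s ((Z - X) *v evolved_state Z \<psi> r))" for r
  have "norm a \<le> norm y" unfolding a_def by (rule norm_evolved_state_le[OF X])
  have "0 \<le> \<Delta> * norm \<psi>" using diff[of \<psi>] norm_ge_zero order_trans by blast
  have \<Delta>: "0 \<le> \<Delta>" if "\<psi> \<noteq> 0" using \<open>0 \<le> \<Delta> * norm \<psi>\<close> that by (simp add: zero_le_mult_iff)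
  have deriv: "(h has_real_derivative h' r) (at r)" for r
  proof -
    let ?V = "evolved_state X a r" and ?z = "evolved_state Z \<psi> r"
    \<comment> \<open>\<open>\<i> X\<close> is skew-adjoint, so the derivative of the first factor
      subtracts \<open>X\<close> from the generator \<open>Z\<close> of the second.\<close>
    have "(\<i> *s (X *v ?V)) \<bullet> ?z = - (?V \<bullet> (\<i> *s (X *v ?z)))"
      using hermitian_cinner[OF X, of ?V ?z]
      by (simp add: cinner_scale_left cinner_scale_right flip: Re_cinner)
    moreover have "(h has_vector_derivative
        (?V \<bullet> (\<i> *s (Z *v ?z)) + (\<i> *s (X *v ?V)) \<bullet> ?z)) (at r)"
      unfolding h_def
      by (intro bounded_bilinear.has_vector_derivative[OF bounded_bilinear_inner]
          evolved_state_has_vector_derivative X Z)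
    ultimately show ?thesis
      by (simp add: h'_def has_real_derivative_iff_has_vector_derivative
          matrix_vector_mult_diff_rdistrib inner_diff_right vector_ssub_ldistrib)
  qed
  have bound: "h' r \<le> norm y * (\<Delta> * norm \<psi>)" for r
  proof -
    have "h' r \<le> norm (evolved_state X a r) * norm (\<i> *s ((Z - X) *v evolved_state Z \<psi> r))"
      unfolding h'_def by (rule norm_cauchy_schwarz)
    also have "\<dots> \<le> norm y * (\<Delta> * norm \<psi>)"
    proof (rule mult_mono)
      show "norm (evolved_state X a r) \<le> norm y"
        using norm_evolved_state_le[OF X] \<open>norm a \<le> norm y\<close> order_trans by blast
      have "norm (evolved_state Z \<psi> r) \<le> norm \<psi>" by (rule norm_evolved_state_le[OF Z])
      then have "\<Delta> * norm (evolved_state Z \<psi> r) \<le> \<Delta> * norm \<psi>"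
        using \<Delta> by (cases "\<psi> = 0") (auto intro: mult_left_mono)
      then show "norm (\<i> *s ((Z - X) *v evolved_state Z \<psi> r)) \<le> \<Delta> * norm \<psi>"
        using diff[of "evolved_state Z \<psi> r"] by (simp add: norm_vector_scale)
    qed auto
    finally show ?thesis .
  qed
  have "h t - h 0 \<le> t * (norm y * (\<Delta> * norm \<psi>))"
  proof (cases "t = 0")
    case False
    then obtain r where "h t - h 0 = (t - 0) * h' r"
      using MVT2[of 0 t h h'] deriv \<open>0 \<le> t\<close> by auto
    then show ?thesis using bound[of r] \<open>0 \<le> t\<close> by (simp add: mult_left_mono)
  qed simp
  moreover have "h t - h 0 = norm y * norm y"
  proof -
    have "h t = y \<bullet> evolved_state Z \<psi> t"
      by (simp add: h_def a_def evolved_state_neg_inverse[OF X])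
    moreover have "h 0 = y \<bullet> evolved_state X \<psi> t"
      by (simp add: h_def a_def evolved_state_zero[OF X] evolved_state_zero[OF Z] inner_evolved_state[OF X])
    ultimately have "h t - h 0 = y \<bullet> y" by (simp add: y_def inner_diff_right)
    then show ?thesis by (simp add: dot_square_norm power2_eq_square)
  qed
  ultimately have "norm y * norm y \<le> norm y * (t * \<Delta> * norm \<psi>)" by (simp add: mult_ac)
  then have "norm y \<le> t * \<Delta> * norm \<psi>"
    using \<open>0 \<le> t\<close> \<open>0 \<le> \<Delta> * norm \<psi>\<close> by (cases "norm y = 0") (auto simp: mult.assoc)
  then show ?thesis by (simp add: y_def)
qed

text \<open>A single term of the series of \<open>exp N\<close> gives
  \<open>N! \<ge> (N / e)\<^sup>N\<close>. Hence the quotient is at most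
  \<open>(e y / N)\<^sup>N \<le> (1 - L / N)\<^sup>N \<le> exp (- L)\<close>.\<close>

lemma power_div_fact_le:
  fixes y :: real
  assumes "0 \<le> y" "exp 1 * y + L \<le> real N" "0 < N" "0 \<le> L"
  shows "y ^ N / fact N \<le> exp (- L)"
proof -
  have "real N ^ N / fact N \<le> exp (real N)"
  proof -
    have "(\<Sum>k\<in>{N}. real N ^ k /\<^sub>R fact k) \<le> (\<Sum>k. real N ^ k /\<^sub>R fact k)"
      by (intro sum_le_suminf summable_exp_generic) auto
    then show ?thesis by (simp add: exp_def divide_inverse mult.commute)
  qed
  then have fact: "real N ^ N \<le> exp (real N) * fact N" by (simp add: divide_le_eq)
  have N: "0 < real N" using assms by simp
  have "exp 1 * y / real N \<le> 1 + - L / real N"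
    using assms N by (simp add: field_simps)
  also have "\<dots> \<le> exp (- L / real N)" by (rule exp_ge_add_one_self)
  finally have "(exp 1 * y / real N) ^ N \<le> exp (- L / real N) ^ N"
    using assms N by (intro power_mono) auto
  also have "\<dots> = exp (- L)" using N by (simp flip: exp_of_nat_mult)
  finally have "exp (real N) * y ^ N \<le> exp (- L) * real N ^ N"
    using N by (simp add: power_divide power_mult_distrib divide_le_eq flip: exp_of_nat_mult)
  also have "\<dots> \<le> exp (- L) * (exp (real N) * fact N)" using fact by simp
  finally have "y ^ N \<le> exp (- L) * fact N" by (simp add: mult.left_commute)
  then show ?thesis by (simp add: divide_le_eq)
qed

subsection \<open>Contraction of the potential\<close>

text \<open>The positive part discards eigenvalues below \<open>\<theta>\<close>, whose expected
  relative decrease is too small. The factor \<open>\<lambda>\<close> allows a bound that is linear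
  in a smaller matrix. The bounds below hold for whichever eigenbasis is chosen.\<close>

definition potential :: "real \<Rightarrow> complex^'n^'n \<Rightarrow> real" where
  "potential \<theta> X = (\<Sum>u\<in>(SOME E. eigenbasis X E). eigval X u * max 0 (eigval X u - \<theta>))"

lemma potential_eq:
  assumes "hermitian X"
  obtains E where "eigenbasis X E" "potential \<theta> X = (\<Sum>u\<in>E. eigval X u * max 0 (eigval X u - \<theta>))"
  using someI_ex[OF eigenbasis_exists[OF assms]] unfolding potential_def by blast

lemma potential_le_trace_square:
  assumes "psd X" "0 \<le> \<theta>"
  shows "potential \<theta> X \<le> (real_trace X)\<^sup>2"
proof -
  obtain E where E: "eigenbasis X E" "potential \<theta> X = (\<Sum>u\<in>E. eigval X u * max 0 (eigval X u - \<theta>))"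
    using potential_eq[OF psd_hermitian[OF assms(1)]] by blast
  have fin: "finite E" by (rule eigenbasis_finite[OF E(1)])
  have nn: "0 \<le> eigval X u" for u by (rule eigval_nonneg[OF assms(1)])
  have tr: "real_trace X = (\<Sum>u\<in>E. eigval X u)"
    by (rule real_trace_eq_sum_eigval[OF psd_hermitian[OF assms(1)] E(1)])
  have "potential \<theta> X \<le> (\<Sum>u\<in>E. eigval X u * real_trace X)"
    unfolding E(2)
  proof (intro sum_mono mult_left_mono nn)
    fix u assume "u \<in> E"
    then have "eigval X u \<le> real_trace X" unfolding tr by (intro member_le_sum nn fin)
    then show "max 0 (eigval X u - \<theta>) \<le> real_trace X" using assms(2) nn[of u] by simp
  qed
  also have "\<dots> = (real_trace X)\<^sup>2" by (simp add: tr power2_eq_square flip: sum_distrib_right)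
  finally show ?thesis .
qed

lemma potential_nonneg: "psd X \<Longrightarrow> 0 \<le> potential \<theta> X"
  unfolding potential_def by (intro sum_nonneg mult_nonneg_nonneg eigval_nonneg) auto

lemma quadratic_form_le_if_potential_small:
  assumes X: "psd X" and "\<theta> \<le> \<mu>" "0 \<le> \<mu>" and small: "potential \<theta> X < \<mu> * (\<mu> - \<theta>)"
  shows "x \<bullet> (X *v x) \<le> \<mu> * (norm x)\<^sup>2"
proof -
  obtain E where E: "eigenbasis X E" "potential \<theta> X = (\<Sum>u\<in>E. eigval X u * max 0 (eigval X u - \<theta>))"
    using potential_eq[OF psd_hermitian[OF X]] by blast
  have le: "eigval X u \<le> \<mu>" if "u \<in> E" for u
  proof (rule ccontr)
    assume "\<not> eigval X u \<le> \<mu>"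
    then have "\<mu> * (\<mu> - \<theta>) \<le> eigval X u * max 0 (eigval X u - \<theta>)"
      using assms(2,3) by (intro mult_mono) auto
    also have "\<dots> \<le> potential \<theta> X"
      unfolding E(2) using that eigval_nonneg[OF X]
      by (intro member_le_sum[where f = "\<lambda>u. eigval X u * max 0 (eigval X u - \<theta>)"]
          eigenbasis_finite[OF E(1)] mult_nonneg_nonneg) auto
    finally show False using small by simp
  qed
  show ?thesis
    unfolding quadratic_form_eigen[OF psd_hermitian[OF X] E(1)] norm_parseval[OF E(1)] sum_distrib_left
    by (intro sum_mono mult_right_mono le) auto
qed

text \<open>Jensen's inequality with the weights
  \<open>\<bar>\<langle>w, u\<rangle>\<bar>\<^sup>2\<close>, which sum to
  \<open>\<parallel>u\<parallel>\<^sup>2 = 1\<close>.\<close>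

lemma positive_part_form_le:
  assumes "hermitian R" and E: "eigenbasis R E" and "norm u = 1"
  shows "max 0 (u \<bullet> (R *v u) - \<theta>) \<le> (\<Sum>w\<in>E. (cmod (cinner w u))\<^sup>2 * max 0 (eigval R w - \<theta>))"
proof -
  have "u \<bullet> (R *v u) - \<theta> = (\<Sum>w\<in>E. (cmod (cinner w u))\<^sup>2 * (eigval R w - \<theta>))"
    using norm_parseval[OF E, of u] assms(3)
    by (simp add: quadratic_form_eigen[OF assms(1) E] algebra_simps sum_subtractf flip: sum_distrib_left)
  also have "\<dots> \<le> (\<Sum>w\<in>E. (cmod (cinner w u))\<^sup>2 * max 0 (eigval R w - \<theta>))"
    by (intro sum_mono mult_left_mono) auto
  finally show ?thesis by (auto intro!: sum_nonneg)
qed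

text \<open>The positive parts for \<open>R'\<close> are dominated through \<open>R' \<le> R\<close>
  and Jensen's inequality by those for \<open>R\<close>; exchanging the sums reassembles the form of
  \<open>R'\<close> at the eigenvectors of \<open>R\<close>. The bound is linear in
  \<open>R'\<close> and can therefore be averaged over a random \<open>R'\<close>.\<close>

lemma potential_le_sum_forms:
  assumes R: "psd R" "psd R'" and le: "\<And>x. x \<bullet> (R' *v x) \<le> x \<bullet> (R *v x)" and E: "eigenbasis R E"
  shows "potential \<theta> R' \<le> (\<Sum>w\<in>E. max 0 (eigval R w - \<theta>) * (w \<bullet> (R' *v w)))"
proof -
  obtain F where F: "eigenbasis R' F" "potential \<theta> R' = (\<Sum>u\<in>F. eigval R' u * max 0 (eigval R' u - \<theta>))"
    using potential_eq[OF psd_hermitian[OF R(2)]] by blast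
  have "potential \<theta> R' \<le> (\<Sum>u\<in>F. eigval R' u * (\<Sum>w\<in>E. (cmod (cinner w u))\<^sup>2 * max 0 (eigval R w - \<theta>)))"
    unfolding F(2)
  proof (intro sum_mono mult_left_mono eigval_nonneg[OF R(2)])
    fix u assume "u \<in> F"
    then have "norm u = 1" by (rule orthonormal_norm[OF eigenbasis_orthonormal[OF F(1)]])
    have "max 0 (eigval R' u - \<theta>) \<le> max 0 (u \<bullet> (R *v u) - \<theta>)"
      using le[of u] by (simp add: eigval_def)
    also note positive_part_form_le[OF psd_hermitian[OF R(1)] E \<open>norm u = 1\<close>]
    finally show "max 0 (eigval R' u - \<theta>) \<le> (\<Sum>w\<in>E. (cmod (cinner w u))\<^sup>2 * max 0 (eigval R w - \<theta>))" .
  qed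
  also have "\<dots> = (\<Sum>w\<in>E. max 0 (eigval R w - \<theta>) * (\<Sum>u\<in>F. eigval R' u * (cmod (cinner w u))\<^sup>2))"
    by (subst (1) sum_distrib_left, subst sum.swap) (simp add: sum_distrib_left mult_ac)
  also have "\<dots> = (\<Sum>w\<in>E. max 0 (eigval R w - \<theta>) * (w \<bullet> (R' *v w)))"
    unfolding quadratic_form_eigen[OF psd_hermitian[OF R(2)] F(1)]
    by (subst cinner_commute) (simp only: complex_mod_cnj)
  finally show ?thesis .
qed

lemma power2_norm_vec: "(norm x)\<^sup>2 = (\<Sum>i\<in>UNIV. (cmod (x $ i))\<^sup>2)" for x :: "complex^'n"
  by (simp add: power2_norm_eq_inner inner_vec_def)

lemma psd_diag_zero_row:
  assumes R: "psd R" and "Re (R $ q $ q) = 0"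
  shows "(R *v x) $ q = 0"
proof -
  have "R *v axis q 1 = 0"
    by (rule psd_mult_eq_zero[OF R]) (simp add: axis_inner_mult assms(2))
  then show ?thesis
    using hermitian_cinner[OF psd_hermitian[OF R], of "axis q 1" x]
    by (simp add: cinner_axis_left cinner_zero_left)
qed

text \<open>The sampling weight \<open>p q \<ge> R\<^sub>q\<^sub>q / T\<close> cancels the
  denominator of the pivot: on average each entry of \<open>R x\<close> contributes a decrease of at
  least its squared modulus over \<open>T\<close>. If \<open>R\<^sub>q\<^sub>q = 0\<close>, the
  entry itself vanishes.\<close>

lemma sum_pivot_form_le:
  assumes R: "psd R" and p: "\<And>q. Re (R $ q $ q) \<le> T * p q" "(\<Sum>q\<in>UNIV. p q) = 1" and "0 < T"
  shows "(\<Sum>q\<in>UNIV. p q * (x \<bullet> (pivot R q *v x))) \<le> x \<bullet> (R *v x) - (norm (R *v x))\<^sup>2 / T"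
proof -
  have "p q * (x \<bullet> (pivot R q *v x)) \<le> p q * (x \<bullet> (R *v x)) - (cmod ((R *v x) $ q))\<^sup>2 / T" for q
  proof (cases "Re (R $ q $ q) = 0")
    case True
    then show ?thesis by (simp add: pivot_form[OF R] psd_diag_zero_row[OF R])
  next
    case False
    then have r: "0 < Re (R $ q $ q)" using psd_diag_nonneg[OF R, of q] by linarith
    have "(cmod ((R *v x) $ q))\<^sup>2 * Re (R $ q $ q) \<le> (cmod ((R *v x) $ q))\<^sup>2 * (T * p q)"
      using p(1) by (intro mult_left_mono) auto
    then have "(cmod ((R *v x) $ q))\<^sup>2 / T \<le> p q * ((cmod ((R *v x) $ q))\<^sup>2 / Re (R $ q $ q))"
      using r \<open>0 < T\<close> by (simp add: field_simps)
    then show ?thesis by (simp add: pivot_form[OF R] right_diff_distrib)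
  qed
  then have "(\<Sum>q\<in>UNIV. p q * (x \<bullet> (pivot R q *v x)))
      \<le> (\<Sum>q\<in>UNIV. p q * (x \<bullet> (R *v x)) - (cmod ((R *v x) $ q))\<^sup>2 / T)"
    by (intro sum_mono)
  also have "\<dots> = x \<bullet> (R *v x) - (norm (R *v x))\<^sup>2 / T"
    by (simp add: sum_subtractf p(2) power2_norm_vec flip: sum_distrib_right sum_divide_distrib)
  finally show ?thesis .
qed

text \<open>One random elimination step contracts the potential: by Jensen's inequality for the convex
  function \<open>max 0 (\<lambda> - \<theta>)\<close> it suffices to average the quadratic forms of the pivoted matrix at the
  eigenvectors of \<open>R\<close>, and only eigenvalues above \<open>\<theta>\<close> contribute.\<close>

lemma sum_potential_pivot_le:
  assumes R: "psd R" and p: "\<And>q. Re (R $ q $ q) \<le> T * p q" "(\<Sum>q\<in>UNIV. p q) = 1" "\<And>q. 0 \<le> p q"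
    and "0 < T"
  shows "(\<Sum>q\<in>UNIV. p q * potential \<theta> (pivot R q)) \<le> (1 - \<theta> / T) * potential \<theta> R"
proof -
  obtain E where E: "eigenbasis R E" "potential \<theta> R = (\<Sum>u\<in>E. eigval R u * max 0 (eigval R u - \<theta>))"
    using potential_eq[OF psd_hermitian[OF R]] by blast
  let ?g = "\<lambda>w. max 0 (eigval R w - \<theta>)"
  have "(\<Sum>q\<in>UNIV. p q * potential \<theta> (pivot R q))
      \<le> (\<Sum>q\<in>UNIV. p q * (\<Sum>w\<in>E. ?g w * (w \<bullet> (pivot R q *v w))))"
    by (intro sum_mono mult_left_mono p(3) potential_le_sum_forms R psd_pivot pivot_le E(1))
  also have "\<dots> = (\<Sum>w\<in>E. ?g w * (\<Sum>q\<in>UNIV. p q * (w \<bullet> (pivot R q *v w))))"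
    by (subst (1) sum_distrib_left, subst sum.swap) (simp add: sum_distrib_left mult_ac)
  also have "\<dots> \<le> (\<Sum>w\<in>E. (1 - \<theta> / T) * (eigval R w * ?g w))"
  proof (rule sum_mono)
    fix w assume "w \<in> E"
    let ?l = "eigval R w"
    have "norm w = 1" by (rule orthonormal_norm[OF eigenbasis_orthonormal[OF E(1)] \<open>w \<in> E\<close>])
    then have "(norm (R *v w))\<^sup>2 = ?l\<^sup>2"
      using eigenbasis_eigval[OF E(1) \<open>w \<in> E\<close>]
      by (simp add: norm_vector_scale)
    then have *: "(\<Sum>q\<in>UNIV. p q * (w \<bullet> (pivot R q *v w))) \<le> ?l - ?l\<^sup>2 / T"
      using sum_pivot_form_le[where x = w, OF R p(1,2) \<open>0 < T\<close>] by (simp add: eigval_def)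
    show "?g w * (\<Sum>q\<in>UNIV. p q * (w \<bullet> (pivot R q *v w))) \<le> (1 - \<theta> / T) * (?l * ?g w)"
    proof (cases "?l \<le> \<theta>")
      case False
      have "\<theta> * ?l \<le> ?l * ?l" using False eigval_nonneg[OF R, of w] by (intro mult_right_mono) auto
      then have "?l - ?l\<^sup>2 / T \<le> (1 - \<theta> / T) * ?l"
        using \<open>0 < T\<close> by (simp add: field_simps power2_eq_square)
      then have "?g w * (\<Sum>q\<in>UNIV. p q * (w \<bullet> (pivot R q *v w))) \<le> ?g w * ((1 - \<theta> / T) * ?l)"
        using * by (intro mult_left_mono) auto
      then show ?thesis by (simp add: mult_ac)
    qed simp
  qed
  also have "\<dots> = (1 - \<theta> / T) * potential \<theta> R" by (simp add: E(2) sum_distrib_left)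
  finally show ?thesis .
qed

text \<open>Induction on the draws: given the indices at \<open>xs\<close>, the one at
  \<open>x\<close> is independent of them and performs one more contraction. As the residual lies
  below \<open>H\<close>, so does its diagonal, and the fixed weights
  \<open>H\<^sub>q\<^sub>q / Tr H\<close> stay admissible at every stage.\<close>

lemma expectation_potential_residual_le:
  fixes H :: "complex^'d^'d" and xs :: "'m::finite list"
  assumes H: "psd H" "H \<noteq> 0" and "distinct xs" and \<theta>: "\<theta> \<le> real_trace H"
  shows "measure_pmf.expectation (Pi_pmf (set xs) d (\<lambda>_. index_pmf H))
      (\<lambda>\<tau>. potential \<theta> (residual H (map \<tau> xs)))
    \<le> (1 - \<theta> / real_trace H) ^ length xs * potential \<theta> H"
  using \<open>distinct xs\<close>
proof (induction xs)
  case (Cons x xs)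
  let ?P = "index_pmf H" and ?Q = "Pi_pmf (set xs) d (\<lambda>_. index_pmf H)" and ?T = "real_trace H"
  have T: "0 < ?T" by (rule real_trace_pos[OF H])
  have x: "x \<notin> set xs" using Cons.prems by simp
  then have map_eq: "map (f(x := y)) xs = map f xs" for f :: "'m \<Rightarrow> 'd" and y by auto
  have step: "(\<Sum>y\<in>UNIV. pmf ?P y * potential \<theta> (pivot (residual H (map f xs)) y))
      \<le> (1 - \<theta> / ?T) * potential \<theta> (residual H (map f xs))" for f
  proof (rule sum_potential_pivot_le[OF psd_residual[OF H(1)]])
    show "Re (residual H (map f xs) $ q $ q) \<le> ?T * pmf ?P q" for q
      using residual_le[OF H(1), of "axis q 1"] T
      by (simp add: axis_inner_mult pmf_index_pmf[OF H])
    show "(\<Sum>y\<in>UNIV. pmf ?P y) = 1" by (rule sum_pmf_eq_1) auto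
  qed (use T in auto)
  have "measure_pmf.expectation (Pi_pmf (set (x # xs)) d (\<lambda>_. ?P))
      (\<lambda>\<tau>. potential \<theta> (residual H (map \<tau> (x # xs))))
    = measure_pmf.expectation (pair_pmf ?P ?Q) (\<lambda>(y, f). potential \<theta> (pivot (residual H (map f xs)) y))"
    using x by (simp add: Pi_pmf_insert case_prod_unfold map_eq)
  also have "\<dots> = (\<Sum>(y, f)\<in>UNIV. potential \<theta> (pivot (residual H (map f xs)) y) * (pmf ?P y * pmf ?Q f))"
    by (subst integral_measure_pmf_real[where A = UNIV]) (auto simp: pmf_pair intro!: sum.cong)
  also have "\<dots> = (\<Sum>f\<in>UNIV. pmf ?Q f *
      (\<Sum>y\<in>UNIV. pmf ?P y * potential \<theta> (pivot (residual H (map f xs)) y)))"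
    by (subst UNIV_Times_UNIV[symmetric], subst sum.cartesian_product[symmetric], subst sum.swap)
      (simp add: sum_distrib_left mult_ac)
  also have "\<dots> \<le> (\<Sum>f\<in>UNIV. pmf ?Q f * ((1 - \<theta> / ?T) * potential \<theta> (residual H (map f xs))))"
    by (intro sum_mono mult_left_mono step) auto
  also have "\<dots> = (1 - \<theta> / ?T) * measure_pmf.expectation ?Q (\<lambda>f. potential \<theta> (residual H (map f xs)))"
    by (subst integral_measure_pmf_real[where A = UNIV]) (auto simp: sum_distrib_left mult_ac)
  \<comment> \<open>Here \<open>\<theta> \<le> Tr H\<close> keeps the factor in front of the
    induction hypothesis nonnegative.\<close>
  also have "\<dots> \<le> (1 - \<theta> / ?T) * ((1 - \<theta> / ?T) ^ length xs * potential \<theta> H)"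
    using Cons \<theta> T by (intro mult_left_mono) auto
  finally show ?case by (simp add: mult_ac)
qed simp

subsection \<open>Error of the approximate state\<close>

lemma sum_matrix_mult_vec: "(\<Sum>k\<in>S. X k) *v y = (\<Sum>k\<in>S. X k *v y)" for X :: "'a \<Rightarrow> complex^'c^'r"
  by (induction S rule: infinite_finite_induct) (simp_all add: matrix_vector_mult_add_rdistrib)

lemma matrix_mult_sum_vec: "X *v (\<Sum>k\<in>S. y k) = (\<Sum>k\<in>S. X *v y k)" for X :: "complex^'c^'r"
  by (induction S rule: infinite_finite_induct) (simp_all add: matrix_vector_right_distrib)

lemma matrix_scale_mult_vec: "matrix_scale c X *v y = c *s (X *v y)"
  by (simp add: matrix_scale_def map_matrix_def matrix_vector_mult_def vec_eq_iff sum_distrib_left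
      mult.assoc)

text \<open>Moves polynomials from the small matrix \<open>D\<close> to the Nystroem approximation,
  using \<open>A D = A B\<^sup>+ A\<^sup>* A = HN A\<close>.\<close>

lemma matrix_pow_intertwine:
  assumes "A ** D = X ** A"
  shows "A ** matrix_pow D j = matrix_pow X j ** A"
proof (induction j)
  case (Suc j)
  have "A ** matrix_pow D (Suc j) = (A ** D) ** matrix_pow D j"
    by (simp add: matrix_pow_def matrix_mul_assoc)
  also have "\<dots> = X ** (A ** matrix_pow D j)" unfolding assms by (simp add: matrix_mul_assoc)
  also have "\<dots> = matrix_pow X (Suc j) ** A" unfolding Suc by (simp add: matrix_pow_def matrix_mul_assoc)
  finally show ?case .
qed (simp add: matrix_pow_def)

text \<open>Since \<open>A D\<^sup>j v = HN\<^sup>j HN \<psi>\<close>, the output is the Taylor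
  polynomial of degree \<open>K\<close> of \<open>exp (\<i> t HN)\<close> applied to
  \<open>\<psi>\<close>; the separate summand \<open>\<psi>\<close> is its constant term.\<close>

lemma approx_state_spectral:
  fixes \<tau> :: "'m::finite \<Rightarrow> 'd::finite"
  assumes H: "psd H" and F: "eigenbasis (nystroem_H H \<tau>) F"
  shows "approx_state H \<psi> K t \<tau> = spectral_sum F
    (\<lambda>u. \<Sum>k\<le>K. (\<i> * of_real (t * eigval (nystroem_H H \<tau>) u)) ^ k / fact k) *v \<psi>"
proof -
  let ?X = "nystroem_H H \<tau>" and ?A = "nystroem_A H \<tau>" and ?D = "nystroem_D H \<tau>"
    and ?v = "nystroem_v H \<tau> \<psi>"
  let ?\<mu> = "\<lambda>u. of_real (eigval ?X u) :: complex"
  define c where "c k = (\<i> * of_real t) ^ k / fact k" for k :: nat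
  have X: "?X = spectral_sum F ?\<mu>"
    by (rule spectral_decomposition[OF hermitian_nystroem_H[OF H] F])
  have "?A ** ?D = ?X ** ?A" by (simp add: nystroem_D_def nystroem_H_def matrix_mul_assoc)
  from matrix_pow_intertwine[OF this]
  have pow: "?A *v (matrix_pow ?D j *v ?v) = matrix_pow ?X j *v (?X *v \<psi>)" for j
    by (simp add: nystroem_v_def nystroem_H_def matrix_vector_mul_assoc matrix_mul_assoc)
  have "approx_state H \<psi> K t \<tau> = \<psi> + (\<Sum>k=1..K. c k *s (matrix_pow ?X (k - 1) *v (?X *v \<psi>)))"
    by (simp add: approx_state_def g_trunc_def sum_matrix_mult_vec matrix_mult_sum_vec
        matrix_scale_mult_vec vector_scalar_commute pow c_def)
  also have "\<dots> = spectral_sum F (\<lambda>u. \<Sum>k\<le>K. c k * ?\<mu> u ^ k) *v \<psi>"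
  proof (rule eigenbasis_vec_eqI[OF F])
    fix u assume u: "u \<in> F"
    note inner = cinner_spectral_sum[OF eigenbasis_orthonormal[OF F] u]
    have pow_u: "cinner u (matrix_pow ?X (k - 1) *v (?X *v \<psi>)) = ?\<mu> u ^ k * cinner u \<psi>" if "k \<in> {1..K}" for k
    proof -
      have "matrix_pow ?X (k - 1) = spectral_sum F (\<lambda>u. ?\<mu> u ^ (k - 1))"
        by (metis X matrix_pow_spectral_sum[OF F])
      then have "cinner u (matrix_pow ?X (k - 1) *v (?X *v \<psi>)) = ?\<mu> u ^ (k - 1) * (?\<mu> u * cinner u \<psi>)"
        by (simp add: inner cinner_eigen[OF hermitian_nystroem_H[OF H] F u])
      also have "\<dots> = ?\<mu> u ^ Suc (k - 1) * cinner u \<psi>" by (simp only: power_Suc2 mult.assoc)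
      also have "Suc (k - 1) = k" using that by simp
      finally show ?thesis .
    qed
    have "{..K} = insert 0 {1..K}" by auto
    then have "(\<Sum>k\<le>K. c k * ?\<mu> u ^ k) = 1 + (\<Sum>k=1..K. c k * ?\<mu> u ^ k)"
      by (simp add: c_def)
    then show "cinner u (\<psi> + (\<Sum>k=1..K. c k *s (matrix_pow ?X (k - 1) *v (?X *v \<psi>))))
        = cinner u (spectral_sum F (\<lambda>u. \<Sum>k\<le>K. c k * ?\<mu> u ^ k) *v \<psi>)"
      by (simp add: inner cinner_add_right cinner_sum_right cinner_scale_right pow_u
          distrib_right sum_distrib_right mult.assoc del: One_nat_def)
  qed
  finally show ?thesis by (simp add: c_def power_mult_distrib mult_ac)
qed

lemma eigval_le_spectral_norm:
  fixes H :: "complex^'d^'d"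
  assumes "norm u = 1"
  shows "u \<bullet> (H *v u) \<le> spectral_norm H"
proof -
  have "u \<bullet> (H *v u) \<le> norm u * norm (H *v u)" by (rule norm_cauchy_schwarz)
  also have "\<dots> \<le> spectral_norm H"
    using onorm[OF matrix_vector_mul_bounded_linear, of H u] assms by (simp add: spectral_norm_def)
  finally show ?thesis .
qed

lemma quadratic_form_le_real_trace:
  assumes "psd H"
  shows "x \<bullet> (H *v x) \<le> real_trace H * (norm x)\<^sup>2"
proof -
  obtain E where E: "eigenbasis H E" using eigenbasis_exists[OF psd_hermitian[OF assms]] by blast
  show ?thesis
    unfolding quadratic_form_eigen[OF psd_hermitian[OF assms] E] norm_parseval[OF E] sum_distrib_left
      real_trace_eq_sum_eigval[OF psd_hermitian[OF assms] E]
    by (intro sum_mono mult_right_mono member_le_sum eigval_nonneg[OF assms] eigenbasis_finite[OF E]) auto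
qed

lemma norm_mult_le_if_quadratic_form_le:
  assumes X: "psd X" and le: "\<And>x. x \<bullet> (X *v x) \<le> C * (norm x)\<^sup>2"
  shows "norm (X *v x) \<le> C * norm x"
proof (cases "x = 0")
  case False
  have "0 \<le> C * (norm x)\<^sup>2" using le[of x] psd_inner_nonneg[OF X, of x] by linarith
  then have "0 \<le> C" using False by (simp add: zero_le_mult_iff)
  obtain E where E: "eigenbasis X E" using eigenbasis_exists[OF psd_hermitian[OF X]] by blast
  have "cmod (of_real (eigval X u)) \<le> C" if "u \<in> E" for u
    using le[of u] orthonormal_norm[OF eigenbasis_orthonormal[OF E] that] eigval_nonneg[OF X, of u]
    by (simp add: eigval_def)
  from norm_spectral_sum_le[where f = "\<lambda>u. of_real (eigval X u)", OF E this \<open>0 \<le> C\<close>] show ?thesis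
    by (simp only: spectral_decomposition[OF psd_hermitian[OF X] E, symmetric])
qed simp

text \<open>Triangle inequality through the exact evolution under the Nystroem approximation:
  Duhamel bounds the change of generator, the Taylor remainder bounds the truncation.\<close>

lemma approx_state_error_le:
  fixes \<tau> :: "'m::finite \<Rightarrow> 'd::finite"
  assumes H: "psd H" and "0 \<le> t" "0 < \<epsilon>" "\<epsilon> \<le> 1"
    and K: "exp 1 * t * spectral_norm H + ln (2 / \<epsilon>) \<le> real K"
    and res: "\<And>x. x \<bullet> ((H - nystroem_H H \<tau>) *v x) \<le> \<Delta> * (norm x)\<^sup>2"
  shows "norm (evolved_state H \<psi> t - approx_state H \<psi> K t \<tau>) \<le> (t * \<Delta> + \<epsilon> / 2) * norm \<psi>"
proof -
  let ?X = "nystroem_H H \<tau>"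
  obtain F where F: "eigenbasis ?X F" using eigenbasis_exists[OF hermitian_nystroem_H[OF H]] by blast
  have dyn: "norm (evolved_state H \<psi> t - evolved_state ?X \<psi> t) \<le> t * \<Delta> * norm \<psi>"
    by (rule norm_evolved_state_diff_le[OF hermitian_nystroem_H[OF H] psd_hermitian[OF H] \<open>0 \<le> t\<close>
          norm_mult_le_if_quadratic_form_le[OF psd_nystroem_residual[OF H] res]])
  let ?p = "\<lambda>u. \<Sum>k\<le>K. (\<i> * of_real (t * eigval ?X u)) ^ k / fact k"
  let ?d = "\<lambda>u. exp (\<i> * of_real (t * eigval ?X u)) - ?p u"
  have "evolved_state ?X \<psi> t - approx_state H \<psi> K t \<tau> = spectral_sum F ?d *v \<psi>"
    by (rule eigenbasis_vec_eqI[OF F])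
      (simp add: evolved_state_spectral[OF hermitian_nystroem_H[OF H] F]
        approx_state_spectral[OF H F] cinner_diff_right cinner_spectral_sum
        eigenbasis_orthonormal[OF F] left_diff_distrib)
  moreover have "norm (spectral_sum F ?d *v \<psi>) \<le> \<epsilon> / 2 * norm \<psi>"
  proof (rule norm_spectral_sum_le[OF F])
    fix u assume "u \<in> F"
    let ?y = "t * eigval ?X u"
    have "norm u = 1" by (rule orthonormal_norm[OF eigenbasis_orthonormal[OF F] \<open>u \<in> F\<close>])
    have y: "0 \<le> ?y" using \<open>0 \<le> t\<close> eigval_nonneg[OF psd_nystroem_H[OF H]]
      by (intro mult_nonneg_nonneg)
    \<comment> \<open>The approximation lies below \<open>H\<close>, so a truncation order chosen
      for the norm of \<open>H\<close> also serves its eigenvalues.\<close>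
    have "eigval ?X u \<le> u \<bullet> (H *v u)"
      using psd_inner_nonneg[OF psd_nystroem_residual[OF H], of u]
      by (simp add: eigval_def matrix_vector_mult_diff_rdistrib inner_diff_right)
    also have "\<dots> \<le> spectral_norm H" by (rule eigval_le_spectral_norm[OF \<open>norm u = 1\<close>])
    finally have "?y \<le> t * spectral_norm H" using \<open>0 \<le> t\<close> by (rule mult_left_mono)
    then have "exp 1 * ?y \<le> exp 1 * (t * spectral_norm H)" by simp
    then have K': "exp 1 * ?y + ln (2 / \<epsilon>) \<le> real (Suc K)"
      using K unfolding mult.assoc of_nat_Suc by linarith
    \<comment> \<open>The polynomial includes degree \<open>K\<close>, so the remainder has order
      \<open>K + 1\<close>.\<close>
    have "cmod (?d u) \<le> ?y ^ Suc K / fact (Suc K)"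
      using iexp_approx1[of ?y K] y by (simp only: abs_of_nonneg)
    also have "?y ^ Suc K / fact (Suc K) \<le> exp (- ln (2 / \<epsilon>))"
      using y assms(3,4) by (intro power_div_fact_le K') auto
    also have "\<dots> = \<epsilon> / 2" using assms(3) by (simp add: exp_minus)
    finally show "cmod (?d u) \<le> \<epsilon> / 2" .
  qed (use assms(3) in simp)
  ultimately have "norm (evolved_state ?X \<psi> t - approx_state H \<psi> K t \<tau>) \<le> \<epsilon> / 2 * norm \<psi>" by (simp only:)
  with dyn norm_triangle_ineq[of "evolved_state H \<psi> t - evolved_state ?X \<psi> t"
      "evolved_state ?X \<psi> t - approx_state H \<psi> K t \<tau>"]
  show ?thesis by (simp add: distrib_right)
qed

theorem theorem5:
  fixes n K M :: nat
    and H :: "complex^'d^'d"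
    and \<psi> :: "complex^'d"
    and \<epsilon> \<delta> t :: real
  assumes "CARD('d) = 2 ^ n"
    and "CARD('m::finite) = M"
    and "H \<noteq> 0"
    and "psd H"
    and "norm \<psi> = 1"
    and "0 < \<epsilon>" "\<epsilon> \<le> 1"
    and "0 < \<delta>" "\<delta> \<le> 1"
    and "1 \<le> K" "1 \<le> M"
    and "0 < t"
    and "real K \<ge> exp 1 * t * spectral_norm H + ln (2 / \<epsilon>)"
    and "real M \<ge> max (405 * real_trace H)
           (72 * real_trace H * t / \<epsilon> * ln (36 * real_trace H * t / (\<epsilon> * \<delta>)))"
  shows "measure_pmf.prob (sample_pmf H :: ('m \<Rightarrow> 'd) pmf)
           {\<tau>. norm (evolved_state H \<psi> t - approx_state H \<psi> K t \<tau>) \<le> \<epsilon>} \<ge> 1 - \<delta>"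
proof -
  define T where "T = real_trace H"
  define \<mu> where "\<mu> = \<epsilon> / (2 * t)"
  define \<theta> where "\<theta> = \<mu> / 2"
  \<comment> \<open>A dimensionless parameter: \<open>\<mu> = T / (2 x)\<close> and
    \<open>\<theta> = T / (4 x)\<close>.\<close>
  define x where "x = T * t / \<epsilon>"
  define L where "L = ln (36 * x / \<delta>)"
  define good where "good \<tau> \<longleftrightarrow> (\<forall>y. y \<bullet> ((H - nystroem_H H \<tau>) *v y) \<le> \<mu> * (norm y)\<^sup>2)"
    for \<tau> :: "'m \<Rightarrow> 'd"
  let ?P = "sample_pmf H :: ('m \<Rightarrow> 'd) pmf"
  have T: "0 < T" unfolding T_def by (rule real_trace_pos[OF assms(4,3)])
  have \<mu>: "0 < \<mu>" and \<theta>: "0 < \<theta>" and x: "0 < x"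
    using assms(6,12) T by (auto simp: \<mu>_def \<theta>_def x_def)
  have err: "norm (evolved_state H \<psi> t - approx_state H \<psi> K t \<tau>) \<le> \<epsilon>" if "good \<tau>" for \<tau> :: "'m \<Rightarrow> 'd"
  proof -
    have "norm (evolved_state H \<psi> t - approx_state H \<psi> K t \<tau>) \<le> (t * \<mu> + \<epsilon> / 2) * norm \<psi>"
      using assms that by (intro approx_state_error_le) (auto simp: good_def)
    then show ?thesis using assms(5,12) by (simp add: \<mu>_def)
  qed
  have bad: "measure_pmf.prob ?P {\<tau>. \<not> good \<tau>} \<le> \<delta>"
  proof (cases "\<theta> \<le> T")
    \<comment> \<open>Here \<open>H \<le> T < \<theta> < \<mu>\<close>, so every sample is good. In
      the other case the contraction factor is nonnegative.\<close>
    case False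
    have "good \<tau>" for \<tau> :: "'m \<Rightarrow> 'd"
      unfolding good_def
    proof
      fix y :: "complex^'d"
      have "y \<bullet> ((H - nystroem_H H \<tau>) *v y) \<le> y \<bullet> (H *v y)"
        using psd_inner_nonneg[OF psd_nystroem_H[OF assms(4)], of y]
        by (simp add: matrix_vector_mult_diff_rdistrib inner_diff_right)
      also have "\<dots> \<le> T * (norm y)\<^sup>2" unfolding T_def by (rule quadratic_form_le_real_trace[OF assms(4)])
      also have "\<dots> \<le> \<mu> * (norm y)\<^sup>2" using False T by (intro mult_right_mono) (auto simp: \<theta>_def)
      finally show "y \<bullet> ((H - nystroem_H H \<tau>) *v y) \<le> \<mu> * (norm y)\<^sup>2" .
    qed
    then show ?thesis using assms(8) by simp
  next
    case True
    \<comment> \<open>An arbitrary enumeration of the sample positions fixes the order of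
      elimination.\<close>
    obtain xs :: "'m list" where xs: "set xs = UNIV" "distinct xs"
      using finite_distinct_list[of "UNIV :: 'm set"] by auto
    have len: "length xs = M" using distinct_card[OF xs(2)] xs(1) assms(2) by simp
    let ?\<Phi> = "\<lambda>\<tau>. potential \<theta> (residual H (map \<tau> xs))"
    have good: "good \<tau>" if "?\<Phi> \<tau> < \<mu> * (\<mu> - \<theta>)" for \<tau>
      unfolding good_def
    proof
      fix y :: "complex^'d"
      have "y \<bullet> ((H - nystroem_H H \<tau>) *v y) \<le> y \<bullet> (residual H (map \<tau> xs) *v y)"
        by (rule nystroem_residual_le_residual[OF assms(4)]) auto
      also have "\<dots> \<le> \<mu> * (norm y)\<^sup>2"
        using \<mu> that
        by (intro quadratic_form_le_if_potential_small[where \<theta> = \<theta>] psd_residual assms(4))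
          (auto simp: \<theta>_def)
      finally show "y \<bullet> ((H - nystroem_H H \<tau>) *v y) \<le> \<mu> * (norm y)\<^sup>2" .
    qed
    have c: "\<mu> * (\<mu> - \<theta>) = T\<^sup>2 / (8 * x\<^sup>2)"
      using assms(6,12) T by (simp add: \<mu>_def \<theta>_def x_def field_simps power2_eq_square)
    have \<theta>T: "\<theta> / T = 1 / (4 * x)"
      using assms(6,12) T by (simp add: \<mu>_def \<theta>_def x_def field_simps)
    have "\<theta> / T \<le> 1" using True T by simp
    then have "1 \<le> 4 * x" unfolding \<theta>T using x by (simp add: divide_le_eq_1)
    then have "1 \<le> 36 * x / \<delta>" using assms(8,9) by (simp add: le_divide_eq)
    then have L: "0 \<le> L" by (simp add: L_def)
    \<comment> \<open>This yields \<open>\<theta> / T * M = M / (4 x) \<ge> 18 L\<close>. The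
      exponent \<open>2 L\<close> suffices, because \<open>exp (- 2 L)\<close> already supplies the
      factor \<open>1 / x\<^sup>2\<close> that offsets the Markov threshold.\<close>
    have "72 * x * L \<le> real M"
      using assms(14) by (simp add: x_def L_def T_def mult.assoc)
    then have LM: "2 * L \<le> \<theta> / T * M"
      using x L unfolding \<theta>T by (simp add: field_simps)
    have "measure_pmf.prob ?P {\<tau>. \<not> good \<tau>} \<le> measure_pmf.prob ?P {\<tau>. \<mu> * (\<mu> - \<theta>) \<le> ?\<Phi> \<tau>}"
      by (rule measure_pmf.finite_measure_mono) (auto simp: not_less[symmetric] dest: good)
    also have "\<dots> \<le> measure_pmf.expectation ?P ?\<Phi> / (\<mu> * (\<mu> - \<theta>))"
    proof -
      have "integrable (measure_pmf ?P) ?\<Phi>" by (rule integrable_measure_pmf_finite) simp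
      then show ?thesis
        using integral_Markov_inequality_measure[of "measure_pmf ?P" ?\<Phi> "{}" "\<mu> * (\<mu> - \<theta>)"]
          T x potential_nonneg[OF psd_residual[OF assms(4)]] by (simp add: c)
    qed
    also have "measure_pmf.expectation ?P ?\<Phi> \<le> (1 - \<theta> / T) ^ M * potential \<theta> H"
      using expectation_potential_residual_le[OF assms(4,3) xs(2), of \<theta> undefined] True
      unfolding T_def sample_pmf_def xs(1) len by blast
    also have "\<dots> \<le> exp (- (2 * L)) * T\<^sup>2"
    proof (rule mult_mono)
      have "(1 - \<theta> / T) ^ M \<le> exp (- (\<theta> / T)) ^ M"
        using exp_ge_add_one_self[of "- (\<theta> / T)"] True T by (intro power_mono) auto
      also have "\<dots> = exp (- (\<theta> / T * M))" by (simp add: mult.commute flip: exp_of_nat_mult)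
      also have "\<dots> \<le> exp (- (2 * L))" using LM by simp
      finally show "(1 - \<theta> / T) ^ M \<le> exp (- (2 * L))" .
      show "potential \<theta> H \<le> T\<^sup>2"
        unfolding T_def using \<theta> by (intro potential_le_trace_square assms(4)) simp
    qed (use potential_nonneg[OF assms(4)] in auto)
    also have "exp (- (2 * L)) = (\<delta> / (36 * x))\<^sup>2"
      using assms(8) x by (simp add: L_def exp_minus exp_double power_divide flip: power_inverse)
    \<comment> \<open>The threshold contributes
      \<open>T\<^sup>2 / (\<mu> (\<mu> - \<theta>)) = 8 x\<^sup>2\<close>, and
      \<open>36\<^sup>2 / 8 = 162\<close>.\<close>
    also have "(\<delta> / (36 * x))\<^sup>2 * T\<^sup>2 / (\<mu> * (\<mu> - \<theta>)) = \<delta>\<^sup>2 / 162"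
      using T x unfolding c by (simp add: field_simps power2_eq_square)
    also have "\<delta>\<^sup>2 / 162 \<le> \<delta>"
      using assms(8,9) power_le_one_iff[of \<delta> 2] mult_left_le[of \<delta> \<delta>] by (simp add: power2_eq_square)
    finally show ?thesis using c T x by (simp add: divide_right_mono)
  qed
  have "1 - \<delta> \<le> 1 - measure_pmf.prob ?P {\<tau>. \<not> good \<tau>}" using bad by simp
  also have "\<dots> = measure_pmf.prob ?P {\<tau>. good \<tau>}"
    using measure_pmf.prob_compl[of "{\<tau>. \<not> good \<tau>}" ?P] by (simp add: Compl_eq Diff_eq)
  also have "\<dots> \<le> measure_pmf.prob ?P
      {\<tau>. norm (evolved_state H \<psi> t - approx_state H \<psi> K t \<tau>) \<le> \<epsilon>}"
    by (rule measure_pmf.finite_measure_mono) (auto intro: err)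
  finally show ?thesis .
qed

end
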